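(* Let $G$ be a graph with $n$ vertices and chromatic polynomial $P_G$. Define integers $h_0,\dots,h_n$ by $$h_0+h_1t+\cdots+h_nt^n=(1-t)^n\sum_{j=0}^\infty\big[(j+1)^n-P_G(j+1)\big]t^j.$$ Then (1) $h_0\le h_1\le\cdots\le h_{\lfloor (n-2)/2\rfloor}$; (2) for $i\le (n-2)/2$, $h_i\le h_{n-2-i}$; (3) $(h_0,\,h_1-h_0,\,\dots,\,h_{\lceil (n-2)/2\rceil}-h_{\lceil (n-2)/2\rceil-1})$ is an M-vector.
   Context: A sequence of nonnegative integers $(m_0,\dots,m_d)$ is an M-vector if it is the Hilbert function of a homogeneous quotient of a polynomial ring (standard graded), equivalently the degree sequence of an order ideal of monomials; by Macaulay's theorem this holds iff $m_0=1$ and $m_{i+1}\le m_i^{\langle i\rangle}$ for $1\le i\le d-1$, where writing $m_i=\binom{a_i}{i}+\binom{a_{i-1}}{i-1}+\cdots+\binom{a_j}{j}$ with $a_i>a_{i-1}>\cdots>a_j\ge j\ge1$, one sets $m_i^{\langle i\rangle}=\binom{a_i+1}{i+1}+\cdots+\binom{a_j+1}{j+1}$. *)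

theory Defs
  imports
    "Graph_Theory.Digraph"
    "HOL-Library.FuncSet"
    "HOL-Library.Poly_Mapping"
    "HOL-Computational_Algebra.Polynomial"
    "HOL-Computational_Algebra.Formal_Power_Series"
begin

section \<open>Chromatic polynomial\<close>

text \<open>
  A finite simple graph is a \<^locale>\<open>graph\<close>: a finite loop-free symmetric digraph without
  multiple arcs, so that every undirected edge is a pair of opposite arcs.
\<close>

definition proper_colorings :: "('a, 'b) pre_digraph \<Rightarrow> nat \<Rightarrow> ('a \<Rightarrow> nat) set" where
  "proper_colorings G k =
     {c \<in> verts G \<rightarrow>\<^sub>E {..<k}. \<forall>u v. u \<rightarrow>\<^bsub>G\<^esub> v \<longrightarrow> c u \<noteq> c v}"

definition chromatic_poly :: "('a, 'b) pre_digraph \<Rightarrow> int poly" where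
  "chromatic_poly G = (THE p. \<forall>k. poly p (int k) = int (card (proper_colorings G k)))"

lemma card_functions_respecting_relation:
  fixes V :: "'a set"
  assumes "finite V" "R \<subseteq> V \<times> V"
  shows "\<exists>m. \<forall>k::nat. card {c \<in> V \<rightarrow>\<^sub>E {..<k}. \<forall>(u, v)\<in>R. c u = c v} = k ^ m"
proof -
  define r where "r = {(u, v). u \<in> V \<and> v \<in> V \<and> (u, v) \<in> (R \<union> R\<inverse>)\<^sup>*}"
  have symR: "sym ((R \<union> R\<inverse>)\<^sup>*)"
    by (intro sym_rtrancl) (auto simp: sym_def)
  have eq: "equiv V r"
    by (intro equivI) (use symR in \<open>auto simp: r_def refl_on_def sym_def trans_def\<close>)
  have fin: "finite (V // r)"
    using eq assms by (intro finite_quotient) (auto simp: r_def)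
  have "card {c \<in> V \<rightarrow>\<^sub>E {..<k}. \<forall>(u, v)\<in>R. c u = c v} = k ^ card (V // r)" for k :: nat
  proof -
    let ?S = "{c \<in> V \<rightarrow>\<^sub>E {..<k}. \<forall>(u, v)\<in>R. c u = c v}"
    let ?T = "(V // r) \<rightarrow>\<^sub>E {..<k}"
    have const: "c u = c v" if "c \<in> ?S" "(u, v) \<in> r" for c u v
    proof -
      have "(u, v) \<in> (R \<union> R\<inverse>)\<^sup>*" using that by (auto simp: r_def)
      then show ?thesis
        by (induction rule: rtrancl_induct) (use that in auto)
    qed
    have "bij_betw (\<lambda>g. \<lambda>x\<in>V. g (r `` {x})) ?T ?S"
    proof (rule bij_betw_byWitness[where f' = "\<lambda>c. \<lambda>X\<in>V // r. c (SOME x. x \<in> X)"])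
      have some: "(SOME y. y \<in> r `` {x}) \<in> r `` {x}" if "x \<in> V" for x
        using equiv_class_self[OF eq that] by (rule someI)
      show "\<forall>g\<in>?T. (\<lambda>X\<in>V // r. (\<lambda>x\<in>V. g (r `` {x})) (SOME x. x \<in> X)) = g"
      proof (intro ballI ext)
        fix g X assume g: "g \<in> ?T"
        show "(\<lambda>X\<in>V // r. (\<lambda>x\<in>V. g (r `` {x})) (SOME x. x \<in> X)) X = g X"
        proof (cases "X \<in> V // r")
          case True
          then obtain x where x: "x \<in> V" "X = r `` {x}" by (auto elim: quotientE)
          from some[OF x(1)] have "(x, SOME y. y \<in> X) \<in> r" using x by auto
          moreover from this have "r `` {SOME y. y \<in> X} = X"
            using equiv_class_eq[OF eq] x by metis
          ultimately show ?thesis using True by (auto simp: r_def)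
        next
          case False
          then show ?thesis using g by (auto simp: PiE_def extensional_def)
        qed
      qed
      show "\<forall>c\<in>?S. (\<lambda>x\<in>V. (\<lambda>X\<in>V // r. c (SOME x. x \<in> X)) (r `` {x})) = c"
      proof (intro ballI ext)
        fix c x assume c: "c \<in> ?S"
        show "(\<lambda>x\<in>V. (\<lambda>X\<in>V // r. c (SOME x. x \<in> X)) (r `` {x})) x = c x"
        proof (cases "x \<in> V")
          case True
          then have "(x, SOME y. y \<in> r `` {x}) \<in> r" using some by blast
          from const[OF c this] show ?thesis using True by (simp add: quotientI)
        next
          case False
          then show ?thesis using c by (auto simp: PiE_def extensional_def)
        qed
      qed
      show "(\<lambda>g. \<lambda>x\<in>V. g (r `` {x})) ` ?T \<subseteq> ?S"
      proof (safe)
        fix g u v assume g: "g \<in> ?T" and uv: "(u, v) \<in> R"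
        have "(u, v) \<in> r" using uv assms by (auto simp: r_def)
        then have "r `` {u} = r `` {v}" by (rule equiv_class_eq[OF eq])
        then show "(\<lambda>x\<in>V. g (r `` {x})) u = (\<lambda>x\<in>V. g (r `` {x})) v"
          using uv assms by auto
      qed (auto simp: PiE_def Pi_def quotientI)
      show "(\<lambda>c. \<lambda>X\<in>V // r. c (SOME x. x \<in> X)) ` ?S \<subseteq> ?T"
      proof safe
        fix c X assume c: "c \<in> V \<rightarrow>\<^sub>E {..<k}" and X: "X \<in> V // r"
        then obtain x where x: "x \<in> V" "X = r `` {x}" by (auto elim: quotientE)
        from some[OF x(1)] have "(SOME y. y \<in> X) \<in> V" using x by (auto simp: r_def)
        then show "(\<lambda>X\<in>V // r. c (SOME x. x \<in> X)) X < k" using c X by auto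
      qed auto
    qed
    then have "card ?T = card ?S" by (rule bij_betw_same_card)
    then show ?thesis using fin by (simp add: card_funcsetE)
  qed
  then show ?thesis by blast
qed

lemma coloring_count_polynomial:
  fixes V :: "'a set"
  assumes "finite V" "finite A" "A \<subseteq> V \<times> V" "R \<subseteq> V \<times> V"
  shows "\<exists>p :: int poly. \<forall>k. poly p (int k) =
    int (card {c \<in> V \<rightarrow>\<^sub>E {..<k}. (\<forall>(u, v)\<in>A. c u \<noteq> c v) \<and> (\<forall>(u, v)\<in>R. c u = c v)})"
  using assms(2-4)
proof (induction A arbitrary: R rule: finite_induct)
  case empty
  obtain m where m: "\<forall>k::nat. card {c \<in> V \<rightarrow>\<^sub>E {..<k}. \<forall>(u, v)\<in>R. c u = c v} = k ^ m"
    using card_functions_respecting_relation[OF assms(1) empty(2)] by blast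
  show ?case by (rule exI[of _ "monom 1 m"]) (simp add: m poly_monom)
next
  case (insert e A)
  obtain a b where e: "e = (a, b)" by (cases e)
  let ?N = "\<lambda>A R k. {c \<in> V \<rightarrow>\<^sub>E {..<k::nat}. (\<forall>(u, v)\<in>A. c u \<noteq> c v) \<and> (\<forall>(u, v)\<in>R. c u = c v)}"
  obtain p where p: "\<forall>k. poly p (int k) = int (card (?N A R k))"
    using insert.IH[of R] insert.prems by auto
  obtain q where q: "\<forall>k. poly q (int k) = int (card (?N A (insert e R) k))"
    using insert.IH[of "insert e R"] insert.prems by auto
  have "poly (p - q) (int k) = int (card (?N (insert e A) R k))" for k
  proof -
    have fin: "finite (?N A R k)"
      by (rule finite_subset[of _ "V \<rightarrow>\<^sub>E {..<k}"]) (auto intro: finite_PiE assms)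
    have "?N (insert e A) R k = ?N A R k - ?N A (insert e R) k"
      using e by auto
    moreover have sub: "?N A (insert e R) k \<subseteq> ?N A R k" by auto
    ultimately have "card (?N (insert e A) R k) = card (?N A R k) - card (?N A (insert e R) k)"
      using card_Diff_subset[OF finite_subset[OF sub fin] sub] by metis
    moreover have "card (?N A (insert e R) k) \<le> card (?N A R k)"
      using sub fin by (rule card_mono[rotated])
    ultimately show ?thesis using p q by (simp add: of_nat_diff)
  qed
  then show ?case by blast
qed

lemma poly_chromatic_poly:
  assumes "graph G"
  shows "poly (chromatic_poly G) (int k) = int (card (proper_colorings G k))"
proof -
  interpret graph G by fact
  have sub: "arcs_ends G \<subseteq> verts G \<times> verts G"
    by (auto simp: arcs_ends_conv)
  have "finite (arcs_ends G)" by (simp add: arcs_ends_def)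
  then obtain p :: "int poly" where "\<forall>k. poly p (int k) =
    int (card {c \<in> verts G \<rightarrow>\<^sub>E {..<k}.
      (\<forall>(u, v)\<in>arcs_ends G. c u \<noteq> c v) \<and> (\<forall>(u, v)\<in>{}. c u = c v)})"
    using coloring_count_polynomial[OF finite_verts _ sub, of "{}"] by auto
  then have p: "\<forall>k. poly p (int k) = int (card (proper_colorings G k))"
    by (simp add: proper_colorings_def case_prod_unfold split_paired_all Ball_def)
  have uniq: "q = p" if q: "\<forall>k. poly q (int k) = int (card (proper_colorings G k))" for q
  proof (rule ccontr)
    assume "q \<noteq> p"
    then have "finite {x. poly (q - p) x = 0}" by (intro poly_roots_finite) simp
    moreover have "int ` UNIV \<subseteq> {x. poly (q - p) x = 0}" using p q by auto
    ultimately have "finite (int ` UNIV)" by (rule rev_finite_subset)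
    then show False using finite_imageD[of int UNIV] by simp
  qed
  have "chromatic_poly G = p"
    unfolding chromatic_poly_def by (rule the_equality) (use p uniq in blast)+
  then show ?thesis using p by simp
qed

section \<open>M-vectors\<close>

text \<open>
  Polynomials over \<open>'k\<close> in the variables \<open>x\<^sub>0, x\<^sub>1, \<dots>\<close>: exponent vectors with finite
  support are mapped to coefficients. The ring in \<open>r\<close> variables is the subring of those
  polynomials that only involve the variables with index below \<open>r\<close>.
\<close>

type_synonym 'k mpoly = "(nat \<Rightarrow>\<^sub>0 nat) \<Rightarrow>\<^sub>0 'k"

definition mono_deg :: "(nat \<Rightarrow>\<^sub>0 nat) \<Rightarrow> nat" where
  "mono_deg m = (\<Sum>x\<in>Poly_Mapping.keys m. Poly_Mapping.lookup m x)"

definition mpoly_ring :: "nat \<Rightarrow> 'k::field mpoly set" where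
  "mpoly_ring r = {p. \<forall>m\<in>Poly_Mapping.keys p. Poly_Mapping.keys m \<subseteq> {..<r}}"

definition mpoly_forms :: "nat \<Rightarrow> nat \<Rightarrow> 'k::field mpoly set" where
  "mpoly_forms r i = {p \<in> mpoly_ring r. \<forall>m\<in>Poly_Mapping.keys p. mono_deg m = i}"

definition homogeneous_component :: "nat \<Rightarrow> 'k::field mpoly \<Rightarrow> 'k mpoly" where
  "homogeneous_component i p =
     (\<Sum>m | m \<in> Poly_Mapping.keys p \<and> mono_deg m = i.
        Poly_Mapping.single m (Poly_Mapping.lookup p m))"

definition homogeneous_ideal :: "nat \<Rightarrow> 'k::field mpoly set \<Rightarrow> bool" where
  "homogeneous_ideal r I \<longleftrightarrow>
     I \<subseteq> mpoly_ring r \<and> 0 \<in> I \<and>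
     (\<forall>p\<in>I. \<forall>q\<in>I. p + q \<in> I) \<and>
     (\<forall>p\<in>mpoly_ring r. \<forall>q\<in>I. p * q \<in> I) \<and>
     (\<forall>p\<in>I. \<forall>i. homogeneous_component i p \<in> I)"

text \<open>
  \<open>B\<close> represents a basis of the degree-\<open>i\<close> part of the quotient by \<open>I\<close>: modulo \<open>I\<close>, every
  form of degree \<open>i\<close> is a linear combination of \<open>B\<close> with uniquely determined coefficients.
\<close>

definition quotient_basis :: "nat \<Rightarrow> 'k::field mpoly set \<Rightarrow> nat \<Rightarrow> 'k mpoly set \<Rightarrow> bool" where
  "quotient_basis r I i B \<longleftrightarrow>
     finite B \<and> B \<subseteq> mpoly_forms r i \<and>
     (\<forall>p\<in>mpoly_forms r i.
        \<exists>!c. c \<in> extensional B \<and> p - (\<Sum>b\<in>B. Poly_Mapping.single 0 (c b) * b) \<in> I)"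

definition hilbert_value :: "nat \<Rightarrow> 'k::field mpoly set \<Rightarrow> nat \<Rightarrow> nat \<Rightarrow> bool" where
  "hilbert_value r I i n \<longleftrightarrow> (\<exists>B. quotient_basis r I i B \<and> card B = n)"

text \<open>
  The sequence \<open>m 0, \<dots>, m d\<close>, continued by zeros, is the Hilbert function of a homogeneous
  quotient of a polynomial ring over \<open>'k\<close>; which sequences arise does not depend on the field.
  The zero ring is a quotient too, so the zero sequence qualifies; every other sequence
  that qualifies has \<open>m 0 = 1\<close>.
\<close>

definition M_vector :: "'k::field itself \<Rightarrow> nat \<Rightarrow> (nat \<Rightarrow> int) \<Rightarrow> bool" where
  "M_vector _ d m \<longleftrightarrow>
     (\<exists>r (I :: 'k mpoly set). homogeneous_ideal r I \<and>
        (\<forall>i. \<exists>n. hilbert_value r I i n \<and> int n = (if i \<le> d then m i else 0)))"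

end

theory Submission
  imports Defs "HOL-Library.Multiset"
begin

text \<open>
  Let \<open>w(G)\<close> be the numerator \<open>(1 - t)\<^bsup>n+1\<^esup> \<Sum> P\<^sub>G(j + 1) t\<^sup>j\<close>; for the edgeless graph it is the
  Eulerian polynomial \<open>A\<^sub>n\<close>. Splitting strict colourings of an acyclic orientation at the colour of
  a source shows inductively that \<open>w(G)\<close> is a nonnegative combination of polynomials
  \<open>t\<^sup>s (1 + t)\<^sup>m\<close> with \<open>2s + m \<ge> n - 1\<close>. Deletion-contraction writes \<open>h\<close> as \<open>A\<^sub>n\<^sub>-\<^sub>1\<close> plus a sum of
  such numerators of graphs on \<open>n - 1\<close> vertices, which gives (1) and (2).

  For (3), put \<open>g\<^sub>k = h\<^sub>k - h\<^sub>k\<^sub>-\<^sub>1\<close> and let \<open>L\<^sup>N\<^sub>k\<close> be the difference of consecutive Eulerian numbers of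
  \<open>A\<^sub>N\<close>. The decomposition of \<open>h\<close> yields \<open>g\<^sub>k \<ge> L\<^bsup>n-1\<^esup>\<^sub>k\<close>, and \<open>(1 - t) h = A\<^sub>n - w(G)\<close> together with
  \<open>w\<^sub>k \<le> w\<^sub>k\<^sub>+\<^sub>1\<close> yields \<open>g\<^sub>k\<^sub>+\<^sub>1 - g\<^sub>k \<le> L\<^sup>n\<^sub>k\<^sub>+\<^sub>1\<close>. An estimate of Eulerian numbers provides \<open>a\<close> with
  \<open>(a choose k) \<le> L\<^bsup>n-1\<^esup>\<^sub>k\<close> and \<open>L\<^sup>n\<^sub>k\<^sub>+\<^sub>1 \<le> (a choose k + 1)\<close>. These two bounds suffice for the
  colexicographically first \<open>g\<^sub>k\<close> monomials of each degree \<open>k\<close> to form an order ideal.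
\<close>

unbundle fps_syntax

section \<open>A cone of power series\<close>

text \<open>A generator has coefficients symmetric and unimodal about \<open>s + m / 2\<close>; the
  side condition puts this centre at or to the right of \<open>d / 2\<close>.\<close>

inductive binomial_cone :: "nat \<Rightarrow> int fps \<Rightarrow> bool" for d where
  zero: "binomial_cone d 0"
| add: "binomial_cone d p \<Longrightarrow> d \<le> 2 * s + m \<Longrightarrow>
    binomial_cone d (p + fps_X ^ s * (1 + fps_X) ^ m)"

lemma binomial_cone_base:
  assumes "d \<le> 2 * s + m"
  shows "binomial_cone d (fps_X ^ s * (1 + fps_X) ^ m)"
  using binomial_cone.add[OF binomial_cone.zero assms] by simp

lemma binomial_cone_plus:
  assumes "binomial_cone d p" "binomial_cone d q"
  shows "binomial_cone d (p + q)"
  using assms(2)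
proof (induction rule: binomial_cone.induct)
  case zero
  then show ?case using assms(1) by simp
next
  case (add q s m)
  then show ?case
    using binomial_cone.add[of d "p + q" s m] by (simp add: add.assoc)
qed

lemma binomial_cone_sum:
  assumes "\<And>i. i \<in> I \<Longrightarrow> binomial_cone d (f i)"
  shows "binomial_cone d (sum f I)"
  using assms
  by (induction I rule: infinite_finite_induct)
    (auto intro: binomial_cone_plus binomial_cone.zero)

lemma binomial_cone_antimono:
  assumes "binomial_cone d p" "d' \<le> d"
  shows "binomial_cone d' p"
  using assms
  by (induction rule: binomial_cone.induct) (auto intro: binomial_cone.intros)

text \<open>Centres add: the product of two generators is the generator with exponents
  \<open>s + s'\<close> and \<open>m + m'\<close>.\<close>

lemma binomial_cone_mult:
  assumes "binomial_cone d p" "binomial_cone e q"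
  shows "binomial_cone (d + e) (p * q)"
  using assms(1)
proof (induction rule: binomial_cone.induct)
  case zero
  show ?case by (simp add: binomial_cone.zero)
next
  case (add p s m)
  have "binomial_cone (d + e) (fps_X ^ s * (1 + fps_X) ^ m * q)"
    using assms(2)
  proof (induction rule: binomial_cone.induct)
    case zero
    show ?case by (simp add: binomial_cone.zero)
  next
    case (add q s' m')
    have "binomial_cone (d + e) (fps_X ^ s * (1 + fps_X) ^ m * q +
        fps_X ^ (s + s') * (1 + fps_X) ^ (m + m'))"
      using add \<open>d \<le> 2 * s + m\<close> by (intro binomial_cone.add) auto
    then show ?case
      by (simp add: algebra_simps power_add)
  qed
  then show ?case
    using binomial_cone_plus[OF add.IH] by (simp add: distrib_right)
qed

lemma one_plus_X_power_nth: "((1 + fps_X) ^ m :: int fps) $ i = int (m choose i)"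
proof (induction m arbitrary: i)
  case 0
  then show ?case by (cases i) auto
next
  case (Suc m)
  then show ?case
    by (cases i) (simp_all add: distrib_right)
qed

text \<open>If \<open>k'\<close> lies beyond the middle, it is reflected to \<open>n - k'\<close>,
  which is still at least \<open>k\<close> and lies where binomials increase.\<close>

lemma binomial_le_binomial:
  assumes "k \<le> k'" "k + k' \<le> (n::nat)"
  shows "n choose k \<le> n choose k'"
proof (cases "2 * k' \<le> n")
  case True
  then show ?thesis using assms by (intro binomial_mono)
next
  case False
  have "n choose k \<le> n choose (n - k')"
    using False assms by (intro binomial_mono) auto
  then show ?thesis
    using assms binomial_symmetric[of k' n] by simp
qed

text \<open>The purpose of the cone: \<open>i' = i + 1\<close> yields growth up to the middle, and
  \<open>i' = d - i\<close> compares mirrored coefficients.\<close>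

lemma binomial_cone_nth_mono:
  assumes "binomial_cone d p" "i \<le> i'" "i + i' \<le> d"
  shows "p $ i \<le> p $ i'"
  using assms
proof (induction rule: binomial_cone.induct)
  case (add p s m)
  have "(fps_X ^ s * (1 + fps_X) ^ m :: int fps) $ i \<le> (fps_X ^ s * (1 + fps_X) ^ m) $ i'"
  proof (cases "i < s")
    case False
    then have "m choose (i - s) \<le> m choose (i' - s)"
      using add.prems add.hyps by (intro binomial_le_binomial) auto
    then show ?thesis
      using False add.prems by (simp add: fps_X_power_mult_nth one_plus_X_power_nth)
  qed (simp add: fps_X_power_mult_nth one_plus_X_power_nth)
  then show ?case
    using add by simp
qed simp

section \<open>Generating functions of colourings\<close>

text \<open>The two relations interpolate between graphs (\<open>D = {}\<close>) and strict orders
  (\<open>A = {}\<close>); a pair moves from \<open>A\<close> to \<open>D\<close> by choosing its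
  orientation.\<close>

definition colorings :: "'a set \<Rightarrow> ('a \<times> 'a) set \<Rightarrow> ('a \<times> 'a) set \<Rightarrow> nat \<Rightarrow> ('a \<Rightarrow> nat) set" where
  "colorings V A D k =
    {c \<in> V \<rightarrow>\<^sub>E {..<k}. (\<forall>(u, v)\<in>A. c u \<noteq> c v) \<and> (\<forall>(u, v)\<in>D. c u < c v)}"

definition coloring_numerator :: "'a set \<Rightarrow> ('a \<times> 'a) set \<Rightarrow> ('a \<times> 'a) set \<Rightarrow> int fps" where
  "coloring_numerator V A D =
    (1 - fps_X) ^ Suc (card V) * Abs_fps (\<lambda>j. int (card (colorings V A D (Suc j))))"

lemma finite_colorings: "finite V \<Longrightarrow> finite (colorings V A D k)"
  unfolding colorings_def by (rule finite_subset[of _ "V \<rightarrow>\<^sub>E {..<k}"]) (auto intro: finite_PiE)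

lemma colorings_no_vertices: "colorings {} {} {} k = {\<lambda>_. undefined}"
  by (auto simp: colorings_def)

lemma colorings_no_colors: "V \<noteq> {} \<Longrightarrow> colorings V A D 0 = {}"
  by (auto simp: colorings_def)

lemma one_minus_X_times_geometric: "(1 - fps_X) * Abs_fps (\<lambda>_. 1) = (1 :: int fps)"
  by (rule fps_ext) (auto simp: left_diff_distrib)

lemma coloring_numerator_no_vertices: "coloring_numerator {} {} {} = 1"
  by (simp add: coloring_numerator_def colorings_no_vertices one_minus_X_times_geometric)

section \<open>Splitting strict colourings at a source\<close>

text \<open>A vertex of smallest colour is a source. Hence without a source there are no colourings
  and the numerator is 0.\<close>

lemma source_if_coloring:
  assumes "finite V" "V \<noteq> {}" "c \<in> colorings V A D k"
  obtains v where "v \<in> V" "\<And>u. u \<in> V \<Longrightarrow> (u, v) \<notin> D"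
proof -
  obtain v where v: "v \<in> V" "\<And>u. u \<in> V \<Longrightarrow> c v \<le> c u"
    using assms(1,2) ex_min_if_finite[of "c ` V"]
    by (metis (no_types, lifting) finite_imageI image_iff image_is_empty imageI leI)
  have "(u, v) \<notin> D" if "u \<in> V" for u
    using v(2)[OF that] assms(3) by (fastforce simp: colorings_def)
  with v(1) show ?thesis by (rule that)
qed

lemma card_split:
  assumes "finite P" "X \<subseteq> P"
  shows "card P = card X + card (P - X)"
  using card_Diff_subset[OF finite_subset[OF assms(2,1)] assms(2)] card_mono[OF assms] by simp

text \<open>The possible sets of vertices other than \<open>v\<close> that a strict colouring gives at most the
  colour of \<open>v\<close>. Ties go to this side because \<open>v\<close> will be a source.\<close>

definition lower_parts :: "'a set \<Rightarrow> ('a \<times> 'a) set \<Rightarrow> 'a \<Rightarrow> 'a set set" where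
  "lower_parts V D v = {X. X \<subseteq> V - {v} \<and> (\<forall>(y, x)\<in>D. x \<in> X \<longrightarrow> y \<in> X)}"

text \<open>The colour \<open>j\<close> of \<open>v\<close> cuts the palette: \<open>X\<close> uses
  the \<open>j + 1\<close> colours up to \<open>j\<close>, \<open>Y\<close> the \<open>i - j\<close>
  colours above. Between the parts arcs increase automatically: none enters \<open>v\<close>, an arc
  into \<open>X\<close> starts in \<open>X\<close>, and an arc into \<open>Y\<close> from outside
  goes from low to high.\<close>

lemma card_colorings_split:
  fixes V :: "'a set"
  assumes "finite V" "v \<in> V" "D \<subseteq> V \<times> V" and source: "\<And>u. (u, v) \<notin> D"
    and X: "X \<in> lower_parts V D v" and j: "j \<le> i"
  defines "Y \<equiv> V - {v} - X"
  shows "card {c \<in> colorings V {} D (Suc i). c v = j \<and> {x \<in> V - {v}. c x \<le> j} = X} =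
    card (colorings X {} (D \<inter> X \<times> X) (Suc j)) * card (colorings Y {} (D \<inter> Y \<times> Y) (i - j))"
proof -
  let ?L = "{c \<in> colorings V {} D (Suc i). c v = j \<and> {x \<in> V - {v}. c x \<le> j} = X}"
  let ?P = "colorings X {} (D \<inter> X \<times> X) (Suc j)" and ?Q = "colorings Y {} (D \<inter> Y \<times> Y) (i - j)"
  have XV: "X \<subseteq> V - {v}" and down: "\<And>x y. (y, x) \<in> D \<Longrightarrow> x \<in> X \<Longrightarrow> y \<in> X"
    using X by (auto simp: lower_parts_def)
  let ?f = "\<lambda>c. (restrict c X, \<lambda>y\<in>Y. c y - Suc j)"
  let ?g = "\<lambda>(a, b). \<lambda>x\<in>V. if x = v then j else if x \<in> X then a x else Suc j + b x"
  have "bij_betw ?f ?L (?P \<times> ?Q)"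
  proof (rule bij_betw_byWitness[where f' = ?g])
    show "\<forall>c\<in>?L. ?g (?f c) = c"
    proof
      fix c assume c: "c \<in> ?L"
      have c1: "c \<in> extensional V" "c v = j" "{x \<in> V - {v}. c x \<le> j} = X"
        using c by (auto simp: colorings_def PiE_def)
      show "?g (?f c) = c"
      proof
        fix x
        show "?g (?f c) x = c x"
          using c1 by (cases "x \<in> V"; cases "x = v"; cases "x \<in> X")
            (auto simp: Y_def extensional_def not_le)
      qed
    qed
    show "\<forall>ab\<in>?P \<times> ?Q. ?f (?g ab) = ab"
    proof
      fix ab assume "ab \<in> ?P \<times> ?Q"
      then obtain a b where ab: "ab = (a, b)" "a \<in> ?P" "b \<in> ?Q" by auto
      have "a \<in> extensional X" "b \<in> extensional Y"
        using ab by (auto simp: colorings_def PiE_def)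
      then show "?f (?g ab) = ab"
        using XV by (auto simp: ab(1) Y_def extensional_def restrict_def fun_eq_iff)
    qed
    show "?f ` ?L \<subseteq> ?P \<times> ?Q"
    proof
      fix ab assume "ab \<in> ?f ` ?L"
      then obtain c where c: "c \<in> ?L" and ab: "ab = ?f c" by auto
      have cv: "c v = j" "{x \<in> V - {v}. c x \<le> j} = X" "\<And>x. x \<in> V \<Longrightarrow> c x < Suc i"
        and cD: "\<And>x y. (x, y) \<in> D \<Longrightarrow> c x < c y"
        using c by (auto simp: colorings_def)
      have X: "c x \<le> j" if "x \<in> X" for x
        using cv that by auto
      have Y: "j < c y" "c y \<le> i" if "y \<in> Y" for y
        using cv(2) cv(3)[of y] that by (auto simp: Y_def)
      have "restrict c X \<in> ?P"
        using X cD by (auto simp: colorings_def less_Suc_eq_le)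
      moreover have "(\<lambda>y\<in>Y. c y - Suc j) \<in> ?Q"
      proof -
        have "c y - Suc j < i - j" if "y \<in> Y" for y
          using Y[OF that] by simp
        moreover have "c x - Suc j < c y - Suc j" if "(x, y) \<in> D" "x \<in> Y" for x y
          using cD[OF that(1)] Y(1)[OF that(2)] by simp
        ultimately show ?thesis
          by (auto simp: colorings_def)
      qed
      ultimately show "ab \<in> ?P \<times> ?Q"
        by (simp add: ab)
    qed
    show "?g ` (?P \<times> ?Q) \<subseteq> ?L"
    proof
      fix c assume "c \<in> ?g ` (?P \<times> ?Q)"
      then obtain a b where ab: "a \<in> ?P" "b \<in> ?Q" and c: "c = ?g (a, b)" by auto
      have a: "\<And>x. x \<in> X \<Longrightarrow> a x \<le> j" "\<And>x y. (x, y) \<in> D \<Longrightarrow> x \<in> X \<Longrightarrow> y \<in> X \<Longrightarrow> a x < a y"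
        using ab by (auto simp: colorings_def less_Suc_eq_le)
      have b: "\<And>x. x \<in> Y \<Longrightarrow> b x < i - j" "\<And>x y. (x, y) \<in> D \<Longrightarrow> x \<in> Y \<Longrightarrow> y \<in> Y \<Longrightarrow> b x < b y"
        using ab by (auto simp: colorings_def)
      have cX: "c x = a x" if "x \<in> X" for x
        using that XV by (auto simp: c)
      have cY: "c x = Suc j + b x" if "x \<in> Y" for x
        using that by (auto simp: c Y_def)
      have cv: "c v = j"
        using assms(2) by (simp add: c)
      have le: "c x \<le> j" if "x \<in> X" for x
        using a(1)[OF that] cX[OF that] by simp
      have gt: "j < c x" if "x \<in> Y" for x
        using cY[OF that] by simp
      have cases: "x = v \<or> x \<in> X \<or> x \<in> Y" if "x \<in> V" for x
        using that by (auto simp: Y_def)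
      have "c x \<le> i" if "x \<in> V" for x
        using cases[OF that]
      proof (elim disjE)
        assume "x \<in> Y"
        then show ?thesis
          using b(1)[of x] cY[of x] j by simp
      qed (use j cv le in \<open>auto intro: order_trans\<close>)
      then have "c \<in> V \<rightarrow>\<^sub>E {..<Suc i}"
        by (auto simp: PiE_iff less_Suc_eq_le) (simp add: c)
      moreover have "c x < c y" if D: "(x, y) \<in> D" for x y
      proof -
        have xy: "x \<in> V" "y \<in> V" "y \<noteq> v"
          using D assms(3) source by auto
        show ?thesis
        proof (cases "y \<in> X")
          case True
          then show ?thesis
            using down[OF D True] a(2)[OF D] cX by simp
        next
          case False
          then have y: "y \<in> Y"
            using xy by (simp add: Y_def)
          show ?thesis
          proof (cases "x \<in> Y")
            case True
            then show ?thesis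
              using b(2)[OF D True y] cY y by simp
          next
            case False
            then have "c x \<le> j"
              using cases[OF xy(1)] cv le by auto
            then show ?thesis
              using gt[OF y] by simp
          qed
        qed
      qed
      moreover have "{x \<in> V - {v}. c x \<le> j} = X"
      proof (intro equalityI subsetI)
        fix x assume x: "x \<in> {x \<in> V - {v}. c x \<le> j}"
        then show "x \<in> X"
          using cases[of x] gt[of x] by auto
      qed (use XV le in auto)
      ultimately show "c \<in> ?L"
        using cv by (auto simp: colorings_def)
    qed
  qed
  then have "card ?L = card (?P \<times> ?Q)"
    by (rule bij_betw_same_card)
  then show ?thesis
    by (simp only: card_cartesian_product)
qed

lemma card_colorings_source:
  fixes V :: "'a set"
  assumes "finite V" "v \<in> V" "D \<subseteq> V \<times> V" and source: "\<And>u. (u, v) \<notin> D"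
  shows "card (colorings V {} D (Suc i)) =
    (\<Sum>X\<in>lower_parts V D v. \<Sum>j\<le>i. card (colorings X {} (D \<inter> X \<times> X) (Suc j)) *
      card (colorings (V - {v} - X) {} (D \<inter> (V - {v} - X) \<times> (V - {v} - X)) (i - j)))"
proof -
  let ?I = "lower_parts V D v \<times> {..i}"
  let ?T = "\<lambda>(X, j). {c \<in> colorings V {} D (Suc i). c v = j \<and> {x \<in> V - {v}. c x \<le> j} = X}"
  have fin: "finite ?I"
    using assms(1) by (auto simp: lower_parts_def intro!: finite_cartesian_product)
  have "colorings V {} D (Suc i) = (\<Union>p\<in>?I. ?T p)"
  proof (intro equalityI subsetI)
    fix c assume c: "c \<in> colorings V {} D (Suc i)"
    let ?X = "{x \<in> V - {v}. c x \<le> c v}"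
    have "y \<in> ?X" if "(y, x) \<in> D" "x \<in> ?X" for x y
    proof -
      have "c y < c x"
        using c that(1) by (auto simp: colorings_def)
      moreover have "y \<in> V"
        using that(1) assms(3) by auto
      ultimately show ?thesis
        using that(2) by auto
    qed
    then have "?X \<in> lower_parts V D v"
      by (auto simp: lower_parts_def)
    moreover have "c v \<le> i"
      using c assms(2) by (auto simp: colorings_def less_Suc_eq_le)
    ultimately show "c \<in> (\<Union>p\<in>?I. ?T p)"
      using c by (intro UN_I[of "(?X, c v)"]) auto
  qed auto
  also have "card \<dots> = (\<Sum>p\<in>?I. card (?T p))"
    using fin finite_colorings[OF assms(1)] by (intro card_UN_disjoint) auto
  also have "\<dots> = (\<Sum>X\<in>lower_parts V D v. \<Sum>j\<le>i. card (?T (X, j)))"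
    by (subst sum.cartesian_product) (auto intro!: sum.cong)
  also have "\<dots> = (\<Sum>X\<in>lower_parts V D v. \<Sum>j\<le>i. card (colorings X {} (D \<inter> X \<times> X) (Suc j)) *
      card (colorings (V - {v} - X) {} (D \<inter> (V - {v} - X) \<times> (V - {v} - X)) (i - j)))"
    unfolding prod.case by (intro sum.cong refl card_colorings_split[OF assms]) auto
  finally show ?thesis .
qed

text \<open>The sum over \<open>j\<close> is a convolution, so series multiply, and
  \<open>card V + 1 = (card X + 1) + (card Y + 1)\<close> distributes the exponent. The series for
  \<open>Y\<close> starts at 0 colours instead of 1, hence the factor \<open>fps_X\<close>; the
  empty set is special because it has a colouring even without colours.\<close>

lemma coloring_numerator_source:
  fixes V :: "'a set"
  assumes "finite V" "v \<in> V" "D \<subseteq> V \<times> V" and source: "\<And>u. (u, v) \<notin> D"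
  shows "coloring_numerator V {} D = (\<Sum>X\<in>lower_parts V D v.
    let Y = V - {v} - X in coloring_numerator X {} (D \<inter> X \<times> X) *
      (if Y = {} then 1 else fps_X * coloring_numerator Y {} (D \<inter> Y \<times> Y)))"
proof -
  let ?Y = "\<lambda>X. V - {v} - X"
  let ?E = "\<lambda>X. Abs_fps (\<lambda>j. int (card (colorings X {} (D \<inter> X \<times> X) (Suc j))))"
  let ?F = "\<lambda>X. Abs_fps (\<lambda>j. int (card (colorings X {} (D \<inter> X \<times> X) j)))"
  have F: "(1 - fps_X) ^ Suc (card Y) * ?F Y =
      (if Y = {} then 1 else fps_X * coloring_numerator Y {} (D \<inter> Y \<times> Y))" for Y
  proof (cases "Y = {}")
    case True
    then show ?thesis
      by (simp add: colorings_no_vertices one_minus_X_times_geometric)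
  next
    case False
    have "?F Y = fps_X * ?E Y"
      by (rule fps_ext) (simp add: colorings_no_colors[OF False])
    then show ?thesis
      using False by (simp add: coloring_numerator_def mult_ac)
  qed
  have "Abs_fps (\<lambda>j. int (card (colorings V {} D (Suc j)))) =
      (\<Sum>X\<in>lower_parts V D v. ?E X * ?F (?Y X))"
    by (rule fps_ext)
      (simp add: card_colorings_source[OF assms] fps_sum_nth fps_mult_nth atMost_atLeast0)
  then have "coloring_numerator V {} D =
      (\<Sum>X\<in>lower_parts V D v. (1 - fps_X) ^ Suc (card V) * (?E X * ?F (?Y X)))"
    by (simp add: coloring_numerator_def sum_distrib_left)
  also have "\<dots> = (\<Sum>X\<in>lower_parts V D v. coloring_numerator X {} (D \<inter> X \<times> X) *
      (if ?Y X = {} then 1 else fps_X * coloring_numerator (?Y X) {} (D \<inter> ?Y X \<times> ?Y X)))"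
  proof (rule sum.cong[OF refl])
    fix X assume "X \<in> lower_parts V D v"
    then have X: "X \<subseteq> V - {v}" by (simp add: lower_parts_def)
    have "card (V - {v}) = card X + card (?Y X)"
      using X assms(1) by (intro card_split) auto
    moreover have "card V = Suc (card (V - {v}))"
      using assms(1,2) by (rule card.remove)
    ultimately have "(1 - fps_X :: int fps) ^ Suc (card V) =
        (1 - fps_X) ^ Suc (card X) * (1 - fps_X) ^ Suc (card (?Y X))"
      by (simp flip: power_add)
    then have "(1 - fps_X) ^ Suc (card V) * (?E X * ?F (?Y X)) =
        ((1 - fps_X) ^ Suc (card X) * ?E X) * ((1 - fps_X) ^ Suc (card (?Y X)) * ?F (?Y X))"
      by (simp only: mult_ac)
    then show "(1 - fps_X) ^ Suc (card V) * (?E X * ?F (?Y X)) =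
        coloring_numerator X {} (D \<inter> X \<times> X) *
        (if ?Y X = {} then 1 else fps_X * coloring_numerator (?Y X) {} (D \<inter> ?Y X \<times> ?Y X))"
      unfolding F by (simp only: coloring_numerator_def)
  qed
  finally show ?thesis by (simp add: Let_def)
qed

text \<open>Let \<open>P = V - {v}\<close> for a source \<open>v\<close>. If \<open>X\<close> and
  \<open>P - X\<close> are nonempty, the order 2 of \<open>fps_X\<close> makes up for the two losses
  of 1 and gives order \<open>card P\<close>. The term of \<open>X = P\<close> alone falls one
  short; adding that of \<open>X = {}\<close> turns it into \<open>1 + fps_X\<close> times the
  numerator of \<open>P\<close>.\<close>

lemma binomial_cone_strict_numerator:
  fixes V :: "'a set"
  assumes "finite V" "V \<noteq> {}" "D \<subseteq> V \<times> V"
  shows "binomial_cone (card V - 1) (coloring_numerator V {} D)"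
  using assms
proof (induction V arbitrary: D rule: finite_psubset_induct)
  case (psubset V)
  show ?case
  proof (cases "\<exists>v\<in>V. \<forall>u. (u, v) \<notin> D")
    case False
    have "colorings V {} D k = {}" for k
    proof (rule equals0I)
      fix c assume "c \<in> colorings V {} D k"
      then obtain v where "v \<in> V" "\<And>u. u \<in> V \<Longrightarrow> (u, v) \<notin> D"
        using source_if_coloring psubset.hyps psubset.prems(1) by metis
      then show False
        using False psubset.prems(2) by blast
    qed
    then have "coloring_numerator V {} D = 0"
      by (simp add: coloring_numerator_def flip: fps_zero_def)
    then show ?thesis
      by (simp add: binomial_cone.zero)
  next
    case True
    then obtain v where v: "v \<in> V" "\<And>u. (u, v) \<notin> D" by blast
    define P where "P = V - {v}"
    let ?N = "\<lambda>X. coloring_numerator X {} (D \<inter> X \<times> X)"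
    let ?T = "\<lambda>X. ?N X * (if P - X = {} then 1 else fps_X * ?N (P - X))"
    have num: "coloring_numerator V {} D = (\<Sum>X\<in>lower_parts V D v. ?T X)"
      using coloring_numerator_source[OF psubset.hyps v(1) psubset.prems(2) v(2)]
      unfolding Let_def P_def .
    have finP: "finite P"
      using psubset.hyps by (simp add: P_def)
    have cardV: "card V = Suc (card P)"
      unfolding P_def using psubset.hyps v(1) by (rule card.remove)
    have IH: "binomial_cone (card X - 1) (?N X)" if "X \<subseteq> P" "X \<noteq> {}" for X
      using that v(1) by (intro psubset.IH) (auto simp: P_def)
    have cone_X: "binomial_cone 2 fps_X" and cone_X1: "binomial_cone 1 (1 + fps_X)"
      using binomial_cone_base[of 2 1 0] binomial_cone_base[of 1 0 1] by simp_all
    have sub: "X \<subseteq> P" if "X \<in> lower_parts V D v" for X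
      using that by (simp add: lower_parts_def P_def)
    have fin: "finite (lower_parts V D v)"
      using finP sub by (auto intro!: finite_subset[of "lower_parts V D v" "Pow P"])
    have empty: "{} \<in> lower_parts V D v"
      by (simp add: lower_parts_def)
    have N_empty: "?N {} = 1"
      by (simp add: coloring_numerator_no_vertices)
    show ?thesis
    proof (cases "P = {}")
      case True
      then have "lower_parts V D v = {{}}"
        using empty sub by blast
      then show ?thesis
        using True N_empty binomial_cone_base[of 0 0 0] by (simp add: num cardV)
    next
      case False
      define J where "J = lower_parts V D v - {{}, P}"
      have J: "binomial_cone (card P) (?T X)" if "X \<in> J" for X
      proof -
        have X: "X \<subseteq> P" "X \<noteq> {}" "P - X \<noteq> {}"
          using that sub by (auto simp: J_def)
        have "binomial_cone (card X - 1 + (2 + (card (P - X) - 1))) (?N X * (fps_X * ?N (P - X)))"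
          using X by (intro binomial_cone_mult cone_X IH) auto
        moreover have "card X - 1 + (2 + (card (P - X) - 1)) = card P"
        proof -
          have "card P = card X + card (P - X)"
            using finP X(1) by (rule card_split)
          moreover have "card X > 0" "card (P - X) > 0"
            using X finP finite_subset by (auto simp: card_gt_0_iff)
          ultimately show ?thesis by simp
        qed
        ultimately show ?thesis
          using X by simp
      qed
      have T_empty: "?T {} = fps_X * ?N P"
        using False N_empty by simp
      have T_P: "?T P = ?N P" by simp
      have cardP: "card P > 0"
        using False finP by (simp add: card_gt_0_iff)
      have "binomial_cone (card P) ((\<Sum>X\<in>lower_parts V D v \<inter> {{}, P}. ?T X) + (\<Sum>X\<in>J. ?T X))"
      proof (intro binomial_cone_plus binomial_cone_sum[of J] J)
        show "binomial_cone (card P) (\<Sum>X\<in>lower_parts V D v \<inter> {{}, P}. ?T X)"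
        proof (cases "P \<in> lower_parts V D v")
          case True
          then have "lower_parts V D v \<inter> {{}, P} = {{}, P}"
            using empty by auto
          then have "(\<Sum>X\<in>lower_parts V D v \<inter> {{}, P}. ?T X) = ?T {} + ?T P"
            using False by simp
          also have "\<dots> = (1 + fps_X) * ?N P"
            unfolding T_empty T_P by (simp add: algebra_simps)
          finally show ?thesis
            using binomial_cone_mult[OF cone_X1 IH[of P]] False cardP by simp
        next
          \<comment> \<open>Now \<open>v\<close> has an arc into \<open>P\<close>; the term of the
            empty set stays without partner, but its order exceeds the goal by one.\<close>
          case notin: False
          then have "lower_parts V D v \<inter> {{}, P} = {{}}"
            using empty by auto
          then have T: "(\<Sum>X\<in>lower_parts V D v \<inter> {{}, P}. ?T X) = fps_X * ?N P"
            using False N_empty by simp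
          have "binomial_cone (2 + (card P - 1)) (fps_X * ?N P)"
            using False by (intro binomial_cone_mult cone_X IH) simp_all
          then show ?thesis
            unfolding T by (rule binomial_cone_antimono) simp
        qed
      qed
      also have "(\<Sum>X\<in>lower_parts V D v \<inter> {{}, P}. ?T X) + (\<Sum>X\<in>J. ?T X) =
          coloring_numerator V {} D"
        unfolding num J_def by (rule sum.Int_Diff[OF fin, symmetric])
      finally show ?thesis
        by (simp add: cardV)
    qed
  qed
qed

section \<open>From strict orders to graphs\<close>

lemma coloring_numerator_insert:
  assumes "finite V"
  shows "coloring_numerator V (insert (a, b) A) D =
    coloring_numerator V A (insert (a, b) D) + coloring_numerator V A (insert (b, a) D)"
proof -
  have "card (colorings V (insert (a, b) A) D k) =
      card (colorings V A (insert (a, b) D) k) + card (colorings V A (insert (b, a) D) k)" for k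
  proof -
    have "colorings V (insert (a, b) A) D k =
        colorings V A (insert (a, b) D) k \<union> colorings V A (insert (b, a) D) k"
      by (auto simp: colorings_def neq_iff)
    moreover have "colorings V A (insert (a, b) D) k \<inter> colorings V A (insert (b, a) D) k = {}"
      by (auto simp: colorings_def)
    ultimately show ?thesis
      by (simp add: card_Un_disjoint finite_colorings assms)
  qed
  then have "Abs_fps (\<lambda>j. int (card (colorings V (insert (a, b) A) D (Suc j)))) =
      Abs_fps (\<lambda>j. int (card (colorings V A (insert (a, b) D) (Suc j)))) +
      Abs_fps (\<lambda>j. int (card (colorings V A (insert (b, a) D) (Suc j))))"
    by (simp add: fps_eq_iff)
  then show ?thesis
    by (simp add: coloring_numerator_def distrib_left)
qed

text \<open>Orienting every pair of \<open>A\<close> both ways leaves a sum of strict numerators;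
  cyclic choices contribute 0.\<close>

lemma binomial_cone_coloring_numerator:
  fixes V :: "'a set"
  assumes "finite V" "V \<noteq> {}" "A \<subseteq> V \<times> V" "D \<subseteq> V \<times> V"
  shows "binomial_cone (card V - 1) (coloring_numerator V A D)"
proof -
  have "finite A"
    using assms by (meson finite_SigmaI finite_subset)
  then show ?thesis
    using assms(3,4)
  proof (induction A arbitrary: D rule: finite_induct)
    case empty
    then show ?case
      using assms by (intro binomial_cone_strict_numerator)
  next
    case (insert e A)
    obtain a b where e: "e = (a, b)" by (cases e)
    show ?case
      unfolding e coloring_numerator_insert[OF assms(1)]
      using insert e by (intro binomial_cone_plus insert.IH) auto
  qed
qed

section \<open>Improper colourings\<close>

text \<open>The generating polynomial of the \<open>h_i\<close>. For a loop-free \<open>A\<close>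
  the leading terms cancel in the bracket, so the exponent is one less than in
  \<open>coloring_numerator\<close>.\<close>

definition improper_numerator :: "'a set \<Rightarrow> ('a \<times> 'a) set \<Rightarrow> int fps" where
  "improper_numerator V A = (1 - fps_X) ^ card V *
    Abs_fps (\<lambda>j. (int j + 1) ^ card V - int (card (colorings V A {} (Suc j))))"

lemma card_colorings_unconstrained:
  "finite V \<Longrightarrow> card (colorings V {} {} k) = k ^ card V"
  by (simp add: colorings_def card_funcsetE)

lemma card_colorings_identify:
  fixes V :: "'a set" and A :: "('a \<times> 'a) set"
  assumes "finite V" "u \<in> V" "v \<in> V" "u \<noteq> v" "A \<subseteq> V \<times> V"
  defines "r \<equiv> (\<lambda>x. if x = v then u else x)"
  shows "card {c \<in> colorings V A {} k. c u = c v} =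
    card (colorings (V - {v}) (map_prod r r ` A) {} k)"
proof -
  let ?L = "{c \<in> colorings V A {} k. c u = c v}"
  let ?R = "colorings (V - {v}) (map_prod r r ` A) {} k"
  have "bij_betw (\<lambda>c. restrict c (V - {v})) ?L ?R"
  proof (rule bij_betw_byWitness[where f' = "\<lambda>c. \<lambda>x\<in>V. c (r x)"])
    show "\<forall>c\<in>?L. (\<lambda>x\<in>V. restrict c (V - {v}) (r x)) = c"
      using assms by (auto simp: colorings_def r_def fun_eq_iff PiE_def extensional_def)
    show "\<forall>c\<in>?R. restrict (\<lambda>x\<in>V. c (r x)) (V - {v}) = c"
      by (auto simp: colorings_def r_def fun_eq_iff PiE_def extensional_def)
    show "(\<lambda>c. restrict c (V - {v})) ` ?L \<subseteq> ?R"
    proof safe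
      fix c assume c: "c \<in> colorings V A {} k" "c u = c v"
      have "c (r x) = c x" for x
        using c(2) by (simp add: r_def)
      moreover have "r x \<in> V - {v}" if "x \<in> V" for x
        using that assms by (auto simp: r_def)
      ultimately show "restrict c (V - {v}) \<in> ?R"
        using c(1) assms(5) by (fastforce simp: colorings_def)
    qed
    show "(\<lambda>c. \<lambda>x\<in>V. c (r x)) ` ?R \<subseteq> ?L"
    proof safe
      fix c assume c: "c \<in> ?R"
      have rV: "r x \<in> V - {v}" if "x \<in> V" for x
        using that assms by (auto simp: r_def)
      show "(\<lambda>x\<in>V. c (r x)) \<in> colorings V A {} k"
        using c rV assms(5) by (fastforce simp: colorings_def)
      show "(\<lambda>x\<in>V. c (r x)) u = (\<lambda>x\<in>V. c (r x)) v"
        using assms by (simp add: r_def)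
    qed
  qed
  then show ?thesis
    by (rule bij_betw_same_card)
qed

text \<open>Colourings in which \<open>(u, v)\<close> is the first monochromatic pair are colourings of the graph
  with \<open>v\<close> identified with \<open>u\<close>.\<close>

lemma improper_numerator_insert:
  fixes V :: "'a set"
  assumes "finite V" "u \<in> V" "v \<in> V" "u \<noteq> v" "A \<subseteq> V \<times> V"
  defines "r \<equiv> (\<lambda>x. if x = v then u else x)"
  shows "improper_numerator V (insert (u, v) A) =
    improper_numerator V A + coloring_numerator (V - {v}) (map_prod r r ` A) {}"
proof -
  have "int (card (colorings V (insert (u, v) A) {} k)) =
      int (card (colorings V A {} k)) - int (card (colorings (V - {v}) (map_prod r r ` A) {} k))"
    for k
  proof -
    have "colorings V A {} k =
        colorings V (insert (u, v) A) {} k \<union> {c \<in> colorings V A {} k. c u = c v}"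
      by (auto simp: colorings_def)
    also have "card \<dots> =
        card (colorings V (insert (u, v) A) {} k) + card {c \<in> colorings V A {} k. c u = c v}"
    proof (rule card_Un_disjoint)
      show "finite (colorings V (insert (u, v) A) {} k)"
        "finite {c \<in> colorings V A {} k. c u = c v}"
        using finite_colorings[OF assms(1)] by simp_all
    qed (auto simp: colorings_def)
    finally show ?thesis
      using card_colorings_identify[OF assms(1-5), of k] by (simp add: r_def)
  qed
  then have "Abs_fps (\<lambda>j. (int j + 1) ^ card V - int (card (colorings V (insert (u, v) A) {} (Suc j)))) =
      Abs_fps (\<lambda>j. (int j + 1) ^ card V - int (card (colorings V A {} (Suc j)))) +
      Abs_fps (\<lambda>j. int (card (colorings (V - {v}) (map_prod r r ` A) {} (Suc j))))"
    by (simp add: fps_eq_iff)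
  \<comment> \<open>The contraction has one vertex fewer, so both kinds of numerator carry the same
    power of \<open>1 - fps_X\<close>.\<close>
  moreover have "card V = Suc (card (V - {v}))"
    using assms(1,3) by (rule card.remove)
  ultimately show ?thesis
    by (simp add: improper_numerator_def coloring_numerator_def distrib_left)
qed

lemma improper_numerator_empty:
  assumes "finite V"
  shows "improper_numerator V {} = 0"
proof -
  have "Abs_fps (\<lambda>j. (int j + 1) ^ card V - int (card (colorings V {} {} (Suc j)))) = 0"
    by (rule fps_ext) (simp add: card_colorings_unconstrained[OF assms] add.commute)
  then show ?thesis
    by (simp add: improper_numerator_def)
qed

text \<open>The first pair inserted contracts an edgeless graph, which yields an Eulerian numerator
  exactly; of each later contraction only membership in the cone is kept.\<close>

lemma improper_numerator_decomposition:
  fixes V :: "'a set"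
  assumes "finite V" "A \<subseteq> V \<times> V" "A \<noteq> {}" "\<And>x. (x, x) \<notin> A"
  shows "\<exists>v\<in>V. \<exists>p. binomial_cone (card V - 2) p \<and>
    improper_numerator V A = coloring_numerator (V - {v}) {} {} + p"
proof -
  have "finite A"
    using assms by (meson finite_SigmaI finite_subset)
  then show ?thesis
    using assms(3,2,4)
  proof (induction A rule: finite_ne_induct)
    case (singleton e)
    obtain u v where e: "e = (u, v)" by (cases e)
    have "improper_numerator V {e} = coloring_numerator (V - {v}) {} {} + 0"
      using singleton improper_numerator_insert[of V u v "{}"] assms(1)
      by (auto simp: e improper_numerator_empty)
    then show ?case
      using singleton e binomial_cone.zero by blast
  next
    case (insert e A)
    obtain u v where e: "e = (u, v)" by (cases e)
    let ?r = "\<lambda>x. if x = v then u else x"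
    have uv: "u \<in> V" "v \<in> V" "u \<noteq> v" "A \<subseteq> V \<times> V"
      using insert.prems e by auto
    obtain w p where w: "w \<in> V" "binomial_cone (card V - 2) p"
      "improper_numerator V A = coloring_numerator (V - {w}) {} {} + p"
      using insert.IH insert.prems by blast
    \<comment> \<open>The contracted relation has a loop if the reversed pair is already in
      \<open>A\<close>; that numerator is 0, which the cone contains.\<close>
    have "binomial_cone (card (V - {v}) - 1)
        (coloring_numerator (V - {v}) (map_prod ?r ?r ` A) {})"
      using uv assms(1) by (intro binomial_cone_coloring_numerator) (auto split: if_splits)
    moreover have "card (V - {v}) - 1 = card V - 2"
      using uv assms(1) by simp
    ultimately have "binomial_cone (card V - 2)
        (p + coloring_numerator (V - {v}) (map_prod ?r ?r ` A) {})"
      using w(2) by (intro binomial_cone_plus) simp_all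
    moreover have "improper_numerator V (insert e A) = coloring_numerator (V - {w}) {} {} +
        (p + coloring_numerator (V - {v}) (map_prod ?r ?r ` A) {})"
      using improper_numerator_insert[OF assms(1) uv] w(3) by (simp add: e add.assoc)
    ultimately show ?case
      using w(1) by blast
  qed
qed

text \<open>The coefficients on the left are the differences \<open>h_i - h_(i-1)\<close>; this form
  bounds their growth from above.\<close>

lemma one_minus_X_times_improper_numerator:
  assumes "finite V"
  shows "(1 - fps_X) * improper_numerator V A =
    coloring_numerator V {} {} - coloring_numerator V A {}"
proof -
  have "Abs_fps (\<lambda>j. (int j + 1) ^ card V - int (card (colorings V A {} (Suc j)))) =
      Abs_fps (\<lambda>j. int (card (colorings V {} {} (Suc j)))) -
      Abs_fps (\<lambda>j. int (card (colorings V A {} (Suc j))))"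
    by (rule fps_ext) (simp add: card_colorings_unconstrained[OF assms] add.commute)
  then show ?thesis
    by (simp add: improper_numerator_def coloring_numerator_def right_diff_distrib mult.assoc)
qed

section \<open>Eulerian numbers\<close>

text \<open>The number of permutations of \<open>N\<close> elements with \<open>k\<close>
  descents.\<close>

fun eulerian :: "nat \<Rightarrow> nat \<Rightarrow> int" where
  "eulerian 0 k = (if k = 0 then 1 else 0)"
| "eulerian (Suc N) k = (int k + 1) * eulerian N k +
    (if k = 0 then 0 else (int N + 1 - int k) * eulerian N (k - 1))"

text \<open>Multiplying by \<open>fps_X\<close> and differentiating takes the series of
  \<open>(j + 1) ^ N\<close> to that of \<open>(j + 1) ^ (N + 1)\<close>. On numerators this is
  \<open>A \<mapsto> (1 - X) (X A)' + (N + 1) X A\<close>, which is the Eulerian recursion.\<close>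

lemma eulerian_generating_function:
  "Abs_fps (eulerian N) = (1 - fps_X) ^ Suc N * Abs_fps (\<lambda>j. (int j + 1) ^ N)"
proof (induction N)
  case 0
  show ?case
    by (rule fps_ext) (auto simp: left_diff_distrib)
next
  case (Suc N)
  let ?A = "Abs_fps (eulerian N)" and ?F = "\<lambda>N. Abs_fps (\<lambda>j. (int j + 1) ^ N)"
  have A: "Abs_fps (eulerian (Suc N)) =
      (1 - fps_X) * fps_deriv (fps_X * ?A) + fps_const (int N + 1) * (fps_X * ?A)"
  proof (rule fps_ext)
    fix k
    show "Abs_fps (eulerian (Suc N)) $ k =
        ((1 - fps_X) * fps_deriv (fps_X * ?A) + fps_const (int N + 1) * (fps_X * ?A)) $ k"
      by (cases k) (simp_all add: left_diff_distrib algebra_simps)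
  qed
  have F: "?F (Suc N) = fps_deriv (fps_X * ?F N)"
    by (rule fps_ext) (simp add: algebra_simps)
  have XA: "fps_X * ?A = (1 - fps_X) ^ Suc N * (fps_X * ?F N)"
    by (simp add: Suc.IH mult_ac)
  have deriv: "fps_deriv ((1 - fps_X) ^ Suc N :: int fps) =
      - (fps_const (int N + 1) * (1 - fps_X) ^ N)"
    by (subst fps_deriv_power, rule fps_ext) (simp add: algebra_simps)
  have "fps_deriv (fps_X * ?A) = (1 - fps_X) ^ Suc N * ?F (Suc N) +
      - (fps_const (int N + 1) * (1 - fps_X) ^ N) * (fps_X * ?F N)"
    unfolding XA by (subst fps_deriv_mult) (simp only: F deriv)
  moreover have "(1 - fps_X) * ((1 - fps_X) * P * F1 + - (c * P) * B) + c * ((1 - fps_X) * P * B) =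
      (1 - fps_X) * ((1 - fps_X) * P * F1)" for P F1 B c :: "int fps"
    by (simp add: algebra_simps)
  ultimately have "Abs_fps (eulerian (Suc N)) = (1 - fps_X) * ((1 - fps_X) ^ Suc N * ?F (Suc N))"
    unfolding A by (simp only: XA power_Suc)
  then show ?case by (simp only: power_Suc mult.assoc)
qed

lemma eulerian_0 [simp]: "eulerian N 0 = 1"
  by (induction N) auto

lemma eulerian_eq_0: "0 < N \<Longrightarrow> N \<le> k \<Longrightarrow> eulerian N k = 0"
proof (induction N arbitrary: k)
  case (Suc N)
  then show ?case
    by (cases "N = 0"; cases "k = Suc N") auto
qed simp

lemma eulerian_symmetric: "k < N \<Longrightarrow> eulerian N k = eulerian N (N - 1 - k)"
proof (induction N arbitrary: k)
  case (Suc N)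
  show ?case
  proof (cases "k = 0 \<or> k = N")
    case True
    then show ?thesis
      using Suc.IH[of 0] eulerian_eq_0[of N N] by (cases "N = 0") auto
  next
    case False
    then have k: "0 < k" "k < N" using Suc.prems by auto
    have "eulerian N k = eulerian N (N - 1 - k)" "eulerian N (k - 1) = eulerian N (N - 1 - (k - 1))"
      using k Suc.IH[of k] Suc.IH[of "k - 1"] by auto
    moreover have "N - 1 - (k - 1) = N - k" "N - 1 - k = N - k - 1"
      using k by auto
    ultimately show ?thesis
      using k by (simp add: of_nat_diff algebra_simps)
  qed
qed simp

section \<open>Differences of Eulerian numbers along diagonals\<close>

definition eulerian_diff :: "nat \<Rightarrow> nat \<Rightarrow> int" where
  "eulerian_diff N k = eulerian N k - (if k = 0 then 0 else eulerian N (k - 1))"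

lemma eulerian_diff_Suc:
  "eulerian_diff (Suc N) (Suc k) =
    (int k + 2) * eulerian_diff N (Suc k) + (int N + 1 - int k) * eulerian_diff N k"
  by (cases k) (simp_all add: eulerian_diff_def algebra_simps)

lemma eulerian_diff_middle: "0 < k \<Longrightarrow> eulerian_diff (2 * k) k = 0"
  using eulerian_symmetric[of k "2 * k"] by (simp add: eulerian_diff_def mult_2)

text \<open>Indexing the differences along diagonals makes the recursion symmetric, and the zero
  boundary values come from the symmetry of the Eulerian numbers.\<close>

fun gap :: "nat \<Rightarrow> nat \<Rightarrow> nat" where
  "gap d 0 = 1"
| "gap d (Suc k) = (if d \<le> Suc k then 0 else (k + 2) * gap (d - 1) (Suc k) + (d + 1) * gap d k)"

declare gap.simps(2) [simp del]

text \<open>For \<open>d = k > 0\<close> the zero is the middle of row \<open>2 * k\<close>. For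
  \<open>d < k\<close> the value 0 of \<open>gap\<close> is a mere default, hence the
  restriction.\<close>

lemma gap_eq_eulerian_diff: "k \<le> d \<Longrightarrow> int (gap d k) = eulerian_diff (d + k) k"
proof (induction d k rule: gap.induct)
  case (1 d)
  show ?case by (simp add: eulerian_diff_def)
next
  case (2 d k)
  show ?case
  proof (cases "d = Suc k")
    case True
    then show ?thesis
      using eulerian_diff_middle[of d] by (simp add: mult_2 gap.simps(2))
  next
    case False
    then have d: "\<not> d \<le> Suc k" using 2 by simp
    have "eulerian_diff (d + Suc k) (Suc k) =
        (int k + 2) * eulerian_diff (d + k) (Suc k) + (int (d + k) + 1 - int k) * eulerian_diff (d + k) k"
      using eulerian_diff_Suc[of "d + k" k] by simp
    moreover have "d - 1 + Suc k = d + k" using d by simp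
    ultimately show ?thesis
      using 2(1)[OF d] 2(2)[OF d] d by (simp add: algebra_simps gap.simps(2)[of d])
  qed
qed

lemma gap_pos: "k < d \<Longrightarrow> 0 < gap d k"
proof (induction k arbitrary: d)
  case (Suc k)
  then show ?case by (simp add: gap.simps(2)[of d])
qed simp

lemma gap_rec:
  assumes "Suc k < d"
  shows "real (gap d (Suc k)) = (real k + 2) * real (gap (d - 1) (Suc k)) + (real d + 1) * real (gap d k)"
  using assms by (simp add: algebra_simps gap.simps(2)[of d])

lemma gap_rec_pred:
  assumes "0 < k" "k < d"
  shows "real (gap d k) = (real k + 1) * real (gap (d - 1) k) + (real d + 1) * real (gap d (k - 1))"
  using assms gap_rec[of "k - 1" d] by (simp add: of_nat_diff)

section \<open>Ratios of Eulerian differences\<close>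

text \<open>The assumed ratio limits the second summand of the recursion for \<open>gap d k\<close>
  to the fraction \<open>(i + 3) / (2 * i + 4)\<close>; the rest is the first summand. Stated with
  the ratio as hypothesis because \<open>gap_ratio_ge\<close> uses it within its own
  induction.\<close>

lemma gap_share_aux:
  assumes "k = 0 \<or> (real i + 3) * real (gap d k) \<ge> 2 * (real d + 1) * (real i + 2) * real (gap d (k - 1))"
    and "d = k + 2 + i"
  shows "(real i + 1) * real (gap d k) \<le> (2 * real i + 4) * ((real k + 1) * real (gap (d - 1) k))"
proof (cases "k = 0")
  case False
  have rec: "real (gap d k) = (real k + 1) * real (gap (d - 1) k) + (real d + 1) * real (gap d (k - 1))"
    using False assms(2) by (intro gap_rec_pred) auto
  have "(real i + 3) * real (gap d k) \<ge> (2 * real i + 4) * ((real d + 1) * real (gap d (k - 1)))"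
    using assms(1) False by (simp add: algebra_simps)
  moreover have "(2 * real i + 4) * ((real d + 1) * real (gap d (k - 1))) =
      (2 * real i + 4) * real (gap d k) - (2 * real i + 4) * ((real k + 1) * real (gap (d - 1) k))"
    by (subst rec) (simp add: algebra_simps)
  ultimately show ?thesis
    by (simp add: algebra_simps)
qed simp

text \<open>Outer induction on the column \<open>k\<close>, inner on the distance \<open>i\<close>
  from the zero diagonal. The hypothesis for column \<open>k - 1\<close> bounds the share in column
  \<open>k\<close>, which carries the inner hypothesis from \<open>d - 1\<close> to
  \<open>d\<close>.\<close>

lemma gap_ratio_ge:
  "2 * (real k + 2 + real i) * real i * real (gap (k + 1 + i) k) \<le>
    (real i + 1) * real (gap (k + 1 + i) (Suc k))"
proof (induction k arbitrary: i rule: less_induct)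
  case (less k)
  show ?case
  proof (induction i)
    case 0
    show ?case by simp
  next
    case (Suc j)
    define d where "d = k + 2 + j"
    have d: "k + 1 + Suc j = d" "k + 1 + j = d - 1" by (simp_all add: d_def)
    have rd: "real d = real k + 2 + real j" by (simp add: d_def)
    define G G1 H H1 where "G = real (gap d k)" "G1 = real (gap (d - 1) k)"
      "H = real (gap d (Suc k))" "H1 = real (gap (d - 1) (Suc k))"
    note defs = this
    have share: "(real j + 1) * G \<le> (2 * real j + 4) * ((real k + 1) * G1)"
      unfolding defs
    proof (rule gap_share_aux)
      show "k = 0 \<or> 2 * (real d + 1) * (real j + 2) * real (gap d (k - 1)) \<le> (real j + 3) * real (gap d k)"
      proof (cases k)
        case (Suc k')
        have "k' + 1 + (j + 2) = d" by (simp add: d_def Suc)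
        then show ?thesis
          using less.IH[of k' "j + 2"] Suc by (simp add: rd algebra_simps)
      qed simp
    qed (simp add: d_def)
    have IH: "2 * real d * real j * G1 \<le> (real j + 1) * H1"
      using Suc.IH unfolding d defs by (simp add: rd)
    have rec: "H = (real k + 2) * H1 + (real d + 1) * G"
      unfolding defs by (rule gap_rec) (simp add: d_def)
    have "real d * real j * ((real j + 1) * G) \<le> real d * real j * ((2 * real j + 4) * ((real k + 1) * G1))"
      using share by (intro mult_left_mono) auto
    also have "\<dots> = (real k + 1) * (real j + 2) * (2 * real d * real j * G1)"
      by (simp add: algebra_simps)
    also have "\<dots> \<le> (real k + 1) * (real j + 2) * ((real j + 1) * H1)"
      using IH by (intro mult_left_mono) auto
    finally have "(real j + 1) * (real d * real j * G) \<le> (real j + 1) * ((real k + 1) * (real j + 2) * H1)"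
      by (simp add: mult_ac)
    then have 1: "real d * real j * G \<le> (real k + 1) * (real j + 2) * H1"
      by (simp add: mult_le_cancel_left_pos)
    \<comment> \<open>Here \<open>2 * (j + 1)\<close> is split as \<open>j + (j + 2)\<close>: the
      second part is the contribution of \<open>(d + 1) * G\<close> to \<open>H\<close>, the first
      is paid for by \<open>H1\<close>.\<close>
    have "(real k + 1) * (2 * (real d + 1) * (real j + 1) * G) =
        (real k + 1) * (real d + 1) * real j * G + (real k + 1) * (real j + 2) * ((real d + 1) * G)"
      by (simp add: algebra_simps)
    also have "(real k + 1) * (real d + 1) * real j * G \<le> (real k + 2) * real d * real j * G"
      unfolding defs by (intro mult_right_mono) (auto simp: rd algebra_simps)
    also have "(real k + 2) * real d * real j * G \<le> (real k + 2) * ((real k + 1) * (real j + 2) * H1)"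
      using mult_left_mono[OF 1, of "real k + 2"] by (simp add: mult_ac)
    finally have "(real k + 1) * (2 * (real d + 1) * (real j + 1) * G) \<le>
        (real k + 1) * ((real j + 2) * H)"
      unfolding rec by (simp add: algebra_simps)
    then have "2 * (real d + 1) * (real j + 1) * G \<le> (real j + 2) * H"
      by (simp add: mult_le_cancel_left_pos)
    then show ?case
      unfolding d defs by (simp add: rd algebra_simps)
  qed
qed

lemma gap_share:
  assumes "d = k + 2 + i"
  shows "(real i + 1) * real (gap d k) \<le> (2 * real i + 4) * ((real k + 1) * real (gap (d - 1) k))"
proof (rule gap_share_aux[OF _ assms])
  show "k = 0 \<or> 2 * (real d + 1) * (real i + 2) * real (gap d (k - 1)) \<le> (real i + 3) * real (gap d k)"
  proof (cases k)
    case (Suc k')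
    have "k' + 1 + (i + 2) = d" using assms Suc by simp
    then show ?thesis
      using gap_ratio_ge[of k' "i + 2"] Suc assms by (simp add: algebra_simps)
  qed simp
qed

section \<open>Growth of Eulerian differences\<close>

text \<open>With \<open>y = 2 / R\<close> the claim reduces to
  \<open>(1 + y) * (1 - y / k) ^ k \<le> 1\<close>, a consequence of Bernoulli's
  \<open>1 + y \<le> (1 + y / k) ^ k\<close>. It gives an explicit lower bound for the
  \<open>k\<close>-th root of the right side.\<close>

lemma mean_power_bound:
  fixes R :: real
  assumes "0 < R" "0 < k" "2 / R \<le> real k"
  shows "((R + 2) * (real k - 2 / R)) ^ k \<le> real k * R * (real k * (R + 2)) ^ (k - 1)"
proof -
  define y where "y = 2 / R"
  have y: "0 < y" "R + 2 = R * (1 + y)" "y \<le> real k"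
    using assms by (auto simp: y_def field_simps)
  have k: "0 < real k" using assms by simp
  have "0 < y / real k" using y(1) k by (rule divide_pos_pos)
  then have b: "1 + y \<le> (1 + y / real k) ^ k"
    using Bernoulli_inequality[of "y / real k" k] k by simp
  have z: "0 \<le> 1 - y / real k" "1 - y / real k \<le> 1"
    using y k by (auto simp: field_simps)
  have "(1 + y) * (1 - y / real k) ^ k \<le> (1 + y / real k) ^ k * (1 - y / real k) ^ k"
    using b z by (intro mult_right_mono) auto
  also have "\<dots> = (1 - (y / real k)\<^sup>2) ^ k"
    by (simp add: power_mult_distrib[symmetric] algebra_simps power2_eq_square)
  also have "\<dots> \<le> 1"
  proof (rule power_le_one)
    have "(y / real k)\<^sup>2 \<le> 1\<^sup>2"
      using y k by (intro power_mono) (auto simp: field_simps)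
    then show "0 \<le> 1 - (y / real k)\<^sup>2" by simp
  qed simp
  finally have main: "(R + 2) * (1 - y / real k) ^ k \<le> R"
    using assms(1) unfolding y(2) by (simp add: mult.assoc)
  have "((R + 2) * (real k - 2 / R)) ^ k = (real k * (R + 2) * (1 - y / real k)) ^ k"
    using k by (simp add: y_def field_simps)
  also have "\<dots> = (real k * (R + 2)) ^ k * (1 - y / real k) ^ k"
    by (rule power_mult_distrib)
  also have "\<dots> = (real k * (R + 2)) ^ (k - 1) * (real k * ((R + 2) * (1 - y / real k) ^ k))"
    using assms(2) by (cases k) (simp_all add: mult_ac)
  also have "\<dots> \<le> (real k * (R + 2)) ^ (k - 1) * (real k * R)"
    using main assms by (intro mult_left_mono) auto
  finally show ?thesis by (simp add: mult_ac)
qed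

text \<open>In the next lemma \<open>\<mu>\<close> is the share of the first summand in the recursion for
  \<open>gap d k\<close>, \<open>R1\<close> the ratio of consecutive values on the previous diagonal, and \<open>t\<close> bounds
  the \<open>k\<close>-th root of \<open>\<mu> / (k + 1)\<close>.\<close>

lemma growth_step:
  fixes \<mu> D R1 Y t :: real
  assumes k: "2 \<le> k" and D: "2 \<le> D" and \<mu>: "0 < \<mu>" "\<mu> < 1" and R1: "0 \<le> R1"
    and diag: "((real k + 1) * (R1 + 2)) ^ k \<le> Y * (\<mu> / (real k + 1))"
    and row: "real k * (D / (1 - \<mu>)) * (real k * (D / (1 - \<mu>) + 2)) ^ (k - 1) \<le> Y"
    and t: "0 \<le> t" "\<mu> / (real k + 1) \<le> t ^ k"
      "(1 - \<mu>) * (real k + 1 + 1 / D) \<le> real k * (1 - (real k + 2) / (real k + 1) * \<mu> * t)"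
    and w: "2 * (1 - \<mu>) * (2 + 1 / real k) + 4 * (1 - \<mu>)\<^sup>2 * (real k + 1) / (real k * D) \<le> 3"
  shows "((real k + 1) * (D + (real k + 2) / (real k + 1) * \<mu> * R1 + 2)) ^ k \<le> Y"
proof -
  define x where "x = real k"
  define w where "w = 1 - \<mu>"
  define R where "R = D / w"
  define E where "E = (x + 2) / (x + 1)"
  define L where "L = 1 - E * \<mu> * t"
  \<comment> \<open>\<open>M\<close> is an explicit lower bound for the root \<open>r\<close> of
    \<open>Y\<close>. The goal follows by splitting \<open>r = L * r + E * \<mu> * t * r\<close>:
    the last part covers the term with \<open>R1\<close>, and \<open>L * M\<close> covers the
    rest.\<close>
  define M where "M = (R + 2) * (x - 2 / R)"
  define r where "r = root k Y"
  have x: "2 \<le> x" using k by (simp add: x_def)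
  have w01: "0 < w" "w < 1" using \<mu> by (auto simp: w_def)
  have R: "2 < R" using D w01 by (simp add: R_def field_simps)
  have "2 / R \<le> 1" using R by simp
  then have "2 / R \<le> x" using x by simp
  then have M: "0 \<le> M" using R by (simp add: M_def)
  have MY: "M ^ k \<le> Y"
    using mean_power_bound[of R k] R k row \<open>2 / R \<le> x\<close>
    unfolding M_def x_def R_def w_def by simp
  have Y: "0 \<le> Y" using MY M by (meson order_trans zero_le_power)
  have k0: "0 < k" using k by simp
  have r: "0 \<le> r" "r ^ k = Y"
    using Y k0 by (auto simp: r_def real_root_pow_pos2)
  have Mr: "M \<le> r"
    using MY r M k0 by (metis power_mono_iff)
  have R1r: "(x + 1) * (R1 + 2) \<le> t * r"
  proof -
    have "((x + 1) * (R1 + 2)) ^ k \<le> Y * t ^ k"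
      using diag mult_left_mono[OF t(2) Y] by (simp add: x_def)
    then have "((x + 1) * (R1 + 2)) ^ k \<le> (t * r) ^ k"
      by (simp add: power_mult_distrib r mult.commute)
    then show ?thesis
      using k0 r t R1 x by (subst (asm) power_mono_iff) auto
  qed
  have E: "0 < E" "E * (x + 1) = x + 2" using x by (auto simp: E_def)
  have L: "w * (x + 1 + 1 / D) \<le> x * L"
    using t(3) by (simp add: L_def E_def x_def w_def)
  have "0 \<le> L"
  proof -
    have "0 \<le> w * (x + 1 + 1 / D)" using w01 x D by simp
    then show ?thesis using L x by (smt (verit) mult_pos_neg)
  qed
  have wM: "w * M = x * D + 2 * w * (x - 1) - 4 * w\<^sup>2 / D"
    using w01 D by (simp add: M_def R_def field_simps power2_eq_square)
  have "x * ((x + 1) * D - 2 + 2 * (x + 2) * w) \<le> (x + 1 + 1 / D) * (w * M)"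
  proof -
    \<comment> \<open>\<open>T\<close> is the excess of \<open>w * M\<close> over
      \<open>x * D\<close>. The product of \<open>1 / D\<close> and \<open>x * D\<close> leaves
      \<open>x\<close>, which together with the \<open>- 2 * x\<close> on the left makes the 3 in
      hypothesis \<open>w\<close>.\<close>
    define T where "T = 2 * w * (x - 1) - 4 * w\<^sup>2 / D"
    have "4 * w\<^sup>2 / D \<le> 2 * w"
    proof -
      have "2 * w * (2 * w) \<le> 2 * w * D"
        using w01 D by (intro mult_left_mono) auto
      then show ?thesis using D by (simp add: field_simps power2_eq_square)
    qed
    moreover have "2 * w * 1 \<le> 2 * w * (x - 1)"
      using w01 x by (intro mult_left_mono) auto
    ultimately have "0 \<le> T" by (simp add: T_def)
    have "x * (2 * w * (2 + 1 / x) + 4 * w\<^sup>2 * (x + 1) / (x * D)) \<le> x * 3"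
      using w x unfolding x_def[symmetric] w_def[symmetric] by (intro mult_left_mono) auto
    moreover have "x * (2 * w * (2 + 1 / x) + 4 * w\<^sup>2 * (x + 1) / (x * D)) =
        2 * w * (2 * x + 1) + 4 * w\<^sup>2 * (x + 1) / D"
      using x D by (simp add: field_simps)
    ultimately have *: "2 * w * (2 * x + 1) + 4 * w\<^sup>2 * (x + 1) / D \<le> 3 * x"
      by simp
    have "x * ((x + 1) * D - 2 + 2 * (x + 2) * w) \<le> x * (x + 1) * D + x + (x + 1) * T"
      using * by (simp add: T_def algebra_simps add_divide_distrib diff_divide_distrib)
    also have "\<dots> \<le> x * (x + 1) * D + x + (x + 1 + 1 / D) * T"
      using \<open>0 \<le> T\<close> D by (simp add: mult_right_mono)
    also have "\<dots> = (x + 1 + 1 / D) * (x * D + T)"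
      using D by (simp add: field_simps)
    also have "x * D + T = w * M"
      by (simp add: wM T_def)
    finally show ?thesis .
  qed
  also have "\<dots> \<le> x * L * M"
    using mult_right_mono[OF L M] by (simp add: mult_ac)
  also have "\<dots> \<le> x * (L * r)"
    using \<open>0 \<le> L\<close> Mr x by (simp add: mult_left_mono mult.assoc)
  finally have main: "(x + 1) * D - 2 + 2 * (x + 2) * w \<le> L * r"
    using x by (simp add: mult_le_cancel_left_pos)
  have "(x + 1) * (D + E * \<mu> * R1 + 2) = (x + 1) * D - 2 + 2 * (x + 2) * w + E * \<mu> * ((x + 1) * (R1 + 2))"
  proof -
    have "(x + 1) * (D + E * \<mu> * R1 + 2) = (x + 1) * (D + 2) + E * \<mu> * ((x + 1) * (R1 + 2)) - 2 * \<mu> * (E * (x + 1))"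
      by (simp add: algebra_simps)
    then show ?thesis
      unfolding E(2) by (simp add: w_def algebra_simps)
  qed
  also have "\<dots> \<le> L * r + E * \<mu> * (t * r)"
    using main R1r E \<mu> by (intro add_mono mult_left_mono) auto
  also have "\<dots> = r" by (simp add: L_def algebra_simps)
  finally have "(x + 1) * (D + E * \<mu> * R1 + 2) \<le> r" .
  moreover have "0 \<le> (x + 1) * (D + E * \<mu> * R1 + 2)"
    using x D E \<mu> R1 by simp
  ultimately have "((x + 1) * (D + E * \<mu> * R1 + 2)) ^ k \<le> r ^ k"
    by (intro power_mono)
  then show ?thesis
    by (simp add: r x_def E_def)
qed

text \<open>The witness \<open>t\<close> is chosen to make the linear condition an equality. For the
  power condition, with \<open>n = 1 / \<mu>\<close>, the extreme case is \<open>n = \<nu>\<close>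
  and \<open>D = D0\<close>, which is the hypothesis \<open>num\<close>.\<close>

lemma growth_root_bound:
  fixes \<mu> \<nu> D D0 :: real
  assumes k: "2 \<le> k" and D: "0 < D0" "D0 \<le> D" and \<mu>: "1 / \<nu> \<le> \<mu>" "\<mu> < 1" and \<nu>: "1 \<le> \<nu>"
    and pos: "0 < real k - (1 + 1 / D0) * (\<nu> - 1)"
    and num: "1 \<le> \<nu> * (real k + 1) *
      ((real k + 1) * (real k - (1 + 1 / D0) * (\<nu> - 1)) / (real k * (real k + 2))) ^ k"
  shows "\<exists>t\<ge>0. \<mu> / (real k + 1) \<le> t ^ k \<and>
    (1 - \<mu>) * (real k + 1 + 1 / D) \<le> real k * (1 - (real k + 2) / (real k + 1) * \<mu> * t)"
proof -
  define x where "x = real k"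
  define e where "e = 1 + 1 / D"
  define n where "n = 1 / \<mu>"
  define C where "C = (x + 1) / (x * (x + 2))"
  define B where "B = x - (1 + 1 / D0) * (\<nu> - 1)"
  define B' where "B' = x + e - e * \<nu>"
  define t where "t = C * (x + e - e * n)"
  have x: "2 \<le> x" using k by (simp add: x_def)
  have D0: "0 < D" using D by simp
  have e: "1 \<le> e" "e \<le> 1 + 1 / D0"
    using D D0 by (auto simp: e_def frac_le)
  have \<mu>0: "0 < \<mu>"
    using \<mu>(1) \<nu> by (smt (verit) divide_pos_pos)
  have n: "1 \<le> n" "n \<le> \<nu>" "\<mu> * n = 1"
    using \<mu> \<mu>0 \<nu> by (auto simp: n_def field_simps)
  have B: "0 < B" using pos by (simp add: B_def x_def)
  have "e * (\<nu> - 1) \<le> (1 + 1 / D0) * (\<nu> - 1)"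
    using e \<nu> by (intro mult_right_mono) auto
  then have BB': "B \<le> B'" by (simp add: B_def B'_def algebra_simps)
  have B'n: "x + e - e * n = B' * (1 + e * (\<nu> - n) / B')"
    using B BB' by (simp add: B'_def field_simps)
  have C: "0 < C" using x by (simp add: C_def)
  \<comment> \<open>Lowering \<open>n\<close> from \<open>\<nu>\<close> costs the factor
    \<open>n / \<nu>\<close>, but by Bernoulli the \<open>k\<close>-th power gains at least as
    much.\<close>
  have ratio: "\<nu> \<le> n * (1 + e * (\<nu> - n) / B') ^ k"
  proof -
    have nonneg: "0 \<le> e * (\<nu> - n) / B'"
      using e n B BB' by simp
    then have "1 + x * (e * (\<nu> - n) / B') \<le> (1 + e * (\<nu> - n) / B') ^ k"
      using Bernoulli_inequality[of "e * (\<nu> - n) / B'" k] by (simp add: x_def)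
    moreover have "\<nu> \<le> n * (1 + x * (e * (\<nu> - n) / B'))"
    proof -
      have "B' \<le> x * e"
      proof -
        have "x * 1 \<le> x * e" "e * 1 \<le> e * \<nu>"
          using x e \<nu> by (auto intro!: mult_left_mono)
        then show ?thesis by (simp add: B'_def)
      qed
      also have "\<dots> \<le> n * x * e"
        using n x e mult_right_mono[of 1 n "x * e"] by (simp add: mult.assoc)
      finally have "(\<nu> - n) * B' \<le> (\<nu> - n) * (n * x * e)"
        using n by (intro mult_left_mono) auto
      then have "\<nu> - n \<le> n * x * e * (\<nu> - n) / B'"
        using B BB' by (simp add: field_simps)
      then show ?thesis by (simp add: algebra_simps)
    qed
    ultimately show ?thesis
      using n mult_left_mono[of "1 + x * (e * (\<nu> - n) / B')" "(1 + e * (\<nu> - n) / B') ^ k" n] by linarith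
  qed
  have t0: "0 \<le> t"
  proof -
    have "0 \<le> e * (\<nu> - n) / B'"
      using e n B BB' by simp
    then show ?thesis
      using C B BB' unfolding t_def B'n by simp
  qed
  have "1 \<le> \<nu> * (x + 1) * (C * B) ^ k"
    using num by (simp add: x_def B_def C_def)
  also have "\<dots> \<le> \<nu> * (x + 1) * (C * B') ^ k"
    using B BB' C x \<nu> by (intro mult_left_mono power_mono) auto
  also have "\<dots> \<le> n * (1 + e * (\<nu> - n) / B') ^ k * ((x + 1) * (C * B') ^ k)"
    using mult_right_mono[OF ratio, of "(x + 1) * (C * B') ^ k"] B BB' C x by (simp add: mult_ac)
  also have "\<dots> = n * (x + 1) * t ^ k"
    unfolding t_def B'n by (simp add: power_mult_distrib mult_ac)
  finally have "\<mu> * 1 \<le> \<mu> * (n * (x + 1) * t ^ k)"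
    using \<mu>0 by (intro mult_left_mono) auto
  also have "\<dots> = (\<mu> * n) * ((x + 1) * t ^ k)" by (simp add: mult_ac)
  finally have "\<mu> / (x + 1) \<le> t ^ k"
    using x n(3) by (simp add: field_simps)
  moreover have "x * (1 - (x + 2) / (x + 1) * \<mu> * t) = (1 - \<mu>) * (x + 1 + 1 / D)"
  proof -
    have "(x + 2) / (x + 1) * C = 1 / x"
      using x by (simp add: C_def)
    then have "(x + 2) / (x + 1) * \<mu> * t = \<mu> * (1 / x) * (x + e - e * n)"
      unfolding t_def by (metis (no_types, opaque_lifting) mult.assoc mult.commute)
    also have "\<dots> = (\<mu> * (x + e) - e * (\<mu> * n)) / x"
      by (simp add: field_simps)
    finally have "x * (1 - (x + 2) / (x + 1) * \<mu> * t) = x - (\<mu> * (x + e) - e)"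
      using x n(3) by (simp add: field_simps)
    moreover have "x - (\<mu> * (x + e) - e) = (1 - \<mu>) * (x + e)"
      by (simp add: algebra_simps)
    ultimately show ?thesis
      by (simp add: e_def add.assoc)
  qed
  ultimately show ?thesis
    using t0 by (intro exI[of _ t]) (simp add: x_def)
qed

text \<open>With \<open>R\<close> the ratio of \<open>gap d (k + 1)\<close> and \<open>gap d k\<close>, this says that \<open>(k + 1) (R + 2)\<close> is at
  most the \<open>k\<close>-th root of \<open>k! gap d k\<close>. The summand 2 absorbs the rounding of a real solution of
  \<open>(a choose k) = gap d k\<close> to an integer.\<close>

definition gap_growth :: "nat \<Rightarrow> nat \<Rightarrow> bool" where
  "gap_growth d k \<longleftrightarrow> ((k + 1) * (gap d (k + 1) + 2 * gap d k)) ^ k \<le> fact k * gap d k ^ (k + 1)"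

lemma gap_growth_iff:
  assumes "k < d"
  shows "gap_growth d k \<longleftrightarrow>
    ((real k + 1) * (real (gap d (k + 1)) / real (gap d k) + 2)) ^ k \<le> fact k * real (gap d k)"
proof -
  let ?g = "real (gap d k)" and ?h = "real (gap d (k + 1))"
  have g: "0 < ?g" using gap_pos[OF assms] by simp
  have "gap_growth d k \<longleftrightarrow>
      real (((k + 1) * (gap d (k + 1) + 2 * gap d k)) ^ k) \<le> real (fact k * gap d k ^ (k + 1))"
    unfolding gap_growth_def of_nat_le_iff ..
  also have "\<dots> \<longleftrightarrow> ((real k + 1) * (?h + 2 * ?g)) ^ k \<le> fact k * ?g ^ (k + 1)"
    by (simp add: algebra_simps)
  also have "(real k + 1) * (?h + 2 * ?g) = (real k + 1) * (?h / ?g + 2) * ?g"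
    using g by (simp add: field_simps)
  also have "\<dots> ^ k \<le> fact k * ?g ^ (k + 1) \<longleftrightarrow> ((real k + 1) * (?h / ?g + 2)) ^ k * ?g ^ k \<le> fact k * ?g * ?g ^ k"
    by (simp add: power_mult_distrib mult_ac)
  also have "\<dots> \<longleftrightarrow> ((real k + 1) * (?h / ?g + 2)) ^ k \<le> fact k * ?g"
    using g by (intro mult_le_cancel_right_pos) simp
  finally show ?thesis .
qed

text \<open>Multiplying the growth bound of column \<open>k - 1\<close> by \<open>k * R\<close>
  moves its right side to column \<open>k\<close>; this is hypothesis \<open>row\<close> of
  \<open>growth_step\<close>.\<close>

lemma gap_growth_row:
  assumes "gap_growth d (k - 1)" "0 < k" "k < d"
  defines "R \<equiv> real (gap d k) / real (gap d (k - 1))"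
  shows "real k * R * (real k * (R + 2)) ^ (k - 1) \<le> fact k * real (gap d k)"
proof -
  have g: "0 < real (gap d (k - 1))" using gap_pos[of "k - 1" d] assms by simp
  have R: "0 \<le> R" by (simp add: R_def)
  have "(real k * (R + 2)) ^ (k - 1) \<le> fact (k - 1) * real (gap d (k - 1))"
    using assms by (subst (asm) gap_growth_iff) (auto simp: of_nat_diff)
  then have "real k * R * (real k * (R + 2)) ^ (k - 1) \<le>
      real k * R * (fact (k - 1) * real (gap d (k - 1)))"
    using R by (intro mult_left_mono) auto
  also have "\<dots> = (real k * fact (k - 1)) * (R * real (gap d (k - 1)))"
    by (simp add: mult_ac)
  also have "real k * fact (k - 1) = (fact k :: real)"
    using assms(2) by (simp add: fact_reduce)
  also have "R * real (gap d (k - 1)) = real (gap d k)"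
    using g by (simp add: R_def)
  finally show ?thesis .
qed

text \<open>The numerical hypotheses involve only \<open>k\<close>, \<open>\<nu>\<close> and
  \<open>D0\<close>, so one evaluation serves all \<open>d\<close> with
  \<open>D0 \<le> d + 1\<close> whose share is at least \<open>1 / \<nu>\<close>.\<close>

lemma gap_growth_step:
  fixes \<nu> D0 :: real
  assumes k: "2 \<le> k" "k + 2 < d"
    and IH: "gap_growth (d - 1) k" "gap_growth d (k - 1)"
    and share: "real (gap d k) \<le> \<nu> * ((real k + 1) * real (gap (d - 1) k))"
    and \<nu>: "1 \<le> \<nu>" and D0: "2 \<le> D0" "D0 \<le> real d + 1"
    and pos: "0 < real k - (1 + 1 / D0) * (\<nu> - 1)"
    and num: "1 \<le> \<nu> * (real k + 1) *
      ((real k + 1) * (real k - (1 + 1 / D0) * (\<nu> - 1)) / (real k * (real k + 2))) ^ k"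
    and w: "2 * (1 - 1 / \<nu>) * (2 + 1 / real k) +
      4 * (1 - 1 / \<nu>)\<^sup>2 * (real k + 1) / (real k * D0) \<le> 3"
  shows "gap_growth d k"
proof -
  define G G' G1 H H1 where "G = real (gap d k)" "G' = real (gap d (k - 1))"
    "G1 = real (gap (d - 1) k)" "H = real (gap d (k + 1))" "H1 = real (gap (d - 1) (k + 1))"
  note defs = this
  define D where "D = real d + 1"
  define \<mu> where "\<mu> = (real k + 1) * G1 / G"
  have pos': "0 < G" "0 < G'" "0 < G1" "0 \<le> H1"
    using k gap_pos[of k d] gap_pos[of "k - 1" d] gap_pos[of k "d - 1"] by (auto simp: defs)
  have recG: "G = (real k + 1) * G1 + D * G'"
    unfolding defs D_def using k by (intro gap_rec_pred) auto
  have recH: "H = (real k + 2) * H1 + D * G"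
    unfolding defs D_def using k gap_rec[of k d] by simp
  have D: "D0 \<le> D" "2 \<le> D" using D0 by (auto simp: D_def)
  have w_eq: "1 - \<mu> = D * G' / G"
    using pos' recG by (simp add: \<mu>_def field_simps)
  moreover have "0 < D * G' / G"
    using pos' D by simp
  ultimately have "\<mu> < 1" by simp
  moreover have "0 < \<mu>" using pos' by (simp add: \<mu>_def)
  moreover have "1 / \<nu> \<le> \<mu>"
  proof -
    have "G \<le> \<nu> * ((real k + 1) * G1)"
      using share by (simp only: defs)
    then show ?thesis
      using pos' \<nu> unfolding \<mu>_def by (subst frac_le_eq) (auto simp: divide_le_0_iff mult_ac)
  qed
  ultimately have \<mu>: "0 < \<mu>" "\<mu> < 1" "1 / \<nu> \<le> \<mu>" by auto
  \<comment> \<open>The quotient in hypothesis \<open>row\<close> of \<open>growth_step\<close> is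
    thus the actual ratio of neighbours for this \<open>d\<close>.\<close>
  have R': "D / (1 - \<mu>) = G / G'"
    unfolding w_eq using pos' D by (simp add: field_simps)
  obtain t where t: "0 \<le> t" "\<mu> / (real k + 1) \<le> t ^ k"
    "(1 - \<mu>) * (real k + 1 + 1 / D) \<le> real k * (1 - (real k + 2) / (real k + 1) * \<mu> * t)"
    using growth_root_bound[OF k(1) _ D(1) \<mu>(3,2) \<nu> pos num] D0 by auto
  have diag: "((real k + 1) * (H1 / G1 + 2)) ^ k \<le> fact k * G * (\<mu> / (real k + 1))"
  proof -
    have "((real k + 1) * (H1 / G1 + 2)) ^ k \<le> fact k * G1"
      using IH(1) k unfolding defs by (subst (asm) gap_growth_iff) auto
    also have "fact k * G1 = fact k * G * (\<mu> / (real k + 1))"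
      using pos' by (simp add: \<mu>_def)
    finally show ?thesis .
  qed
  have row: "real k * (D / (1 - \<mu>)) * (real k * (D / (1 - \<mu>) + 2)) ^ (k - 1) \<le> fact k * G"
    unfolding R' defs using IH(2) k by (intro gap_growth_row) auto
  have w': "2 * (1 - \<mu>) * (2 + 1 / real k) + 4 * (1 - \<mu>)\<^sup>2 * (real k + 1) / (real k * D) \<le> 3"
  proof (rule order_trans[OF add_mono w])
    show "2 * (1 - \<mu>) * (2 + 1 / real k) \<le> 2 * (1 - 1 / \<nu>) * (2 + 1 / real k)"
      using \<mu> by (intro mult_right_mono) auto
    show "4 * (1 - \<mu>)\<^sup>2 * (real k + 1) / (real k * D) \<le>
        4 * (1 - 1 / \<nu>)\<^sup>2 * (real k + 1) / (real k * D0)"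
      using \<mu> D D0 k by (intro frac_le mult_mono mult_left_mono power_mono) auto
  qed
  have "((real k + 1) * (D + (real k + 2) / (real k + 1) * \<mu> * (H1 / G1) + 2)) ^ k \<le> fact k * G"
    using growth_step[OF k(1) D(2) \<mu>(1,2) _ diag row t w'] pos' by simp
  moreover have "D + (real k + 2) / (real k + 1) * \<mu> * (H1 / G1) = H / G"
  proof -
    have "(real k + 2) / (real k + 1) * \<mu> * (H1 / G1) = (real k + 2) * H1 / G"
      using pos' by (simp add: \<mu>_def)
    then show ?thesis
      using pos' by (simp add: recH field_simps)
  qed
  ultimately show ?thesis
    using k by (subst gap_growth_iff) (auto simp: defs)
qed

section \<open>Tabulated values for small columns\<close>

text \<open>Direct evaluation of \<open>gap\<close> branches at every call; this computes a column
  in one pass from the previous one, with \<open>a\<close> carrying the value at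
  \<open>d - 1\<close>.\<close>

fun gap_column :: "int \<Rightarrow> int \<Rightarrow> int \<Rightarrow> int list \<Rightarrow> int list" where
  "gap_column k d a [] = []"
| "gap_column k d a (g # gs) =
    (let b = (k + 2) * a + (d + 1) * g in b # gap_column k (d + 1) b gs)"

text \<open>List \<open>k\<close> starts at \<open>d = k + 1\<close>. There the next column
  vanishes: \<open>tl\<close> drops this entry, and the vanishing value is the initial 0.\<close>

fun gap_table :: "nat \<Rightarrow> nat \<Rightarrow> int list" where
  "gap_table 0 m = replicate m 1"
| "gap_table (Suc k) m = gap_column (int k) (int k + 2) 0 (tl (gap_table k m))"

lemma gap_column_correct:
  assumes "Suc k < d"
  shows "gap_column (int k) (int d) (int (gap (d - 1) (Suc k))) (map (\<lambda>i. int (gap (d + i) k)) [0..<m]) =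
    map (\<lambda>i. int (gap (d + i) (Suc k))) [0..<m]"
  using assms
proof (induction m arbitrary: d)
  case (Suc m)
  have "[0..<Suc m] = 0 # map Suc [0..<m]"
    by (simp add: map_Suc_upt upt_conv_Cons)
  moreover have "(int k + 2) * int (gap (d - 1) (Suc k)) + (int d + 1) * int (gap d k) = int (gap d (Suc k))"
    using Suc.prems by (simp add: gap.simps(2)[of d] algebra_simps)
  ultimately show ?case
    using Suc.IH[of "Suc d"] Suc.prems by (simp add: Let_def comp_def add.commute)
qed simp

lemma gap_table_correct: "gap_table k m = map (\<lambda>i. int (gap (k + 1 + i) k)) [0..<m - k]"
proof (induction k)
  case 0
  show ?case by (simp add: map_replicate_const)
next
  case (Suc k)
  have "tl (gap_table k m) = map (\<lambda>i. int (gap (k + 2 + i) k)) [0..<m - Suc k]"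
  proof (cases "m - k")
    case (Suc l)
    then have "[0..<m - k] = 0 # map Suc [0..<l]"
      by (simp add: map_Suc_upt upt_conv_Cons)
    then show ?thesis
      using Suc by (simp add: Suc.IH comp_def)
        (metis Suc_eq_plus1 add_diff_cancel_left' diff_diff_left plus_1_eq_Suc)
  qed (simp add: Suc.IH)
  moreover have "gap (Suc k) (Suc k) = 0" by (simp add: gap.simps(2))
  ultimately show ?case
    using gap_column_correct[of k "k + 2" "m - Suc k"] by (simp add: add.commute)
qed

fun int_fact :: "nat \<Rightarrow> int" where
  "int_fact 0 = 1"
| "int_fact (Suc k) = (int k + 1) * int_fact k"

lemma int_fact_eq: "int_fact k = fact k"
  by (induction k) (simp_all add: algebra_simps)

text \<open>The same \<open>d\<close> sits one place earlier in the next list, hence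
  \<open>i - 1\<close>. Length 22 just reaches offset 18 in column 3, the farthest one
  checked.\<close>

definition growth_check :: "nat \<Rightarrow> nat \<Rightarrow> bool" where
  "growth_check k i \<longleftrightarrow>
    (let a = gap_table k 22 ! i; b = gap_table (Suc k) 22 ! (i - 1)
     in ((int k + 1) * (b + 2 * a)) ^ k \<le> int_fact k * a ^ Suc k)"

lemma gap_growth_if_check:
  assumes "growth_check k i" "0 < i" "i < 22 - k"
  shows "gap_growth (k + 1 + i) k"
proof -
  have "gap_table k 22 ! i = int (gap (k + 1 + i) k)"
    using assms(3) by (simp add: gap_table_correct)
  moreover have "gap_table (Suc k) 22 ! (i - 1) = int (gap (k + 1 + i) (Suc k))"
  proof -
    have "i - 1 < 22 - Suc k" using assms by simp
    then have "gap_table (Suc k) 22 ! (i - 1) = int (gap (Suc k + 1 + (i - 1)) (Suc k))"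
      unfolding gap_table_correct by simp
    moreover have "Suc k + 1 + (i - 1) = k + 1 + i" using assms(2) by simp
    ultimately show ?thesis by (simp only:)
  qed
  ultimately have "((int k + 1) * (int (gap (k + 1 + i) (Suc k)) + 2 * int (gap (k + 1 + i) k))) ^ k \<le>
      fact k * int (gap (k + 1 + i) k) ^ Suc k"
    using assms(1) by (simp only: growth_check_def Let_def int_fact_eq)
  then have "int (((k + 1) * (gap (k + 1 + i) (k + 1) + 2 * gap (k + 1 + i) k)) ^ k) \<le>
      int (fact k * gap (k + 1 + i) k ^ (k + 1))"
    by (simp add: algebra_simps)
  then show ?thesis
    unfolding gap_growth_def of_nat_le_iff .
qed

text \<open>Each triple is a column with a half-open range of offsets \<open>i = d - k - 1\<close>:
  the starting values of inductions and the cases left over by the step lemmas.\<close>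

lemma growth_checks:
  "list_all (\<lambda>(k, l, u). list_all (growth_check k) [l..<u])
    [(1, 2, 3), (2, 1, 2), (3, 1, 19), (4, 1, 7), (5, 2, 5), (6, 2, 4), (7, 2, 3), (8, 2, 3)]"
  by code_simp

lemma gap_growth_small:
  assumes "(k, l, u) \<in> {(1, 2, 3), (2, 1, 2), (3, 1, 19), (4, 1, 7), (5, 2, 5), (6, 2, 4),
      (7, 2, 3), (8, 2, 3)}"
    and "l \<le> i" "i < u"
  shows "gap_growth (k + 1 + i) k"
proof (rule gap_growth_if_check)
  show "growth_check k i"
    using growth_checks assms by (auto simp: list_all_iff)
  show "0 < i" "i < 22 - k"
    using assms by auto
qed

lemma gap_values:
  "gap 3 1 = 10" "gap 3 2 = 40" "gap 5 1 = 56" "gap 5 2 = 1071"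
proof -
  have "map (\<lambda>(k, i). gap_table k 22 ! i) [(1, 1), (2, 0), (1, 3), (2, 2)] = [10, 40, 56, 1071]"
    by code_simp
  then have t: "gap_table 1 22 ! 1 = 10" "gap_table 2 22 ! 0 = 40" "gap_table 1 22 ! 3 = 56"
    "gap_table 2 22 ! 2 = 1071"
    by simp_all
  have "int (gap 3 1) = 10" "int (gap 3 2) = 40" "int (gap 5 1) = 56" "int (gap 5 2) = 1071"
    unfolding t[symmetric] gap_table_correct by (simp_all add: eval_nat_numeral)
  then show "gap 3 1 = 10" "gap 3 2 = 40" "gap 5 1 = 56" "gap 5 2 = 1071"
    by linarith+
qed

section \<open>The first two columns\<close>

lemma gap_Suc_1: "2 \<le> d \<Longrightarrow> gap (Suc d) 1 = 2 * gap d 1 + (d + 2)"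
  using gap.simps(2)[of "Suc d" 0] by simp

lemma gap_Suc_2: "2 \<le> d \<Longrightarrow> gap (Suc d) 2 = 3 * gap d 2 + (d + 2) * gap (Suc d) 1"
  using gap.simps(2)[of "Suc d" 1] by (simp add: Suc_1 algebra_simps del: One_nat_def)

lemma gap_1_ge: "4 \<le> d \<Longrightarrow> d + 2 \<le> gap d 1"
proof (induction d rule: nat_induct_at_least)
  case base
  show ?case using gap_Suc_1[of 3] gap_values by simp
next
  case (Suc d)
  then show ?case using gap_Suc_1[of d] by simp
qed

lemma gap_growth_1_iff: "gap_growth d 1 \<longleftrightarrow> 2 * gap d 2 + 4 * gap d 1 \<le> gap d 1 * gap d 1"
  unfolding gap_growth_def one_add_one
  by (simp add: power2_eq_square distrib_left del: One_nat_def)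

text \<open>The bound fails at \<open>d = 3\<close>, where \<open>2 * 40 + 4 * 10 > 10 * 10\<close>,
  so the induction starts at 4. Its step rests on \<open>d + 2 \<le> gap d 1\<close>.\<close>

lemma gap_growth_1:
  assumes "4 \<le> d"
  shows "gap_growth d 1"
  using assms
proof (induction d rule: nat_induct_at_least)
  case base
  show ?case using gap_growth_small[of 1 2 3 2] by (simp add: eval_nat_numeral)
next
  case (Suc d)
  define a b s where "a = gap d 1" "b = gap d 2" "s = d + 2"
  note defs = this
  have IH: "2 * b + 4 * a \<le> a * a"
    using Suc.IH by (simp only: gap_growth_1_iff defs)
  have s: "s \<le> a" using gap_1_ge[OF Suc.hyps] by (simp add: defs)
  have "2 * (3 * b + s * (2 * a + s)) + 4 * (2 * a + s) + 12 * a \<le>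
      3 * (a * a) + 4 * a * s + 2 * s * s + 8 * a + 4 * s"
    using IH by (simp add: algebra_simps)
  moreover have "s * s \<le> a * a" using s by (intro mult_mono) auto
  ultimately have "2 * (3 * b + s * (2 * a + s)) + 4 * (2 * a + s) \<le> (2 * a + s) * (2 * a + s)"
    using s by (simp add: algebra_simps)
  then show ?case
    using Suc.hyps by (simp add: gap_growth_1_iff gap_Suc_1 gap_Suc_2 defs del: One_nat_def)
qed

text \<open>The second summand of the recursion for \<open>gap d 2\<close> thus takes at most two
  fifths, which permits \<open>\<nu> = 5 / 3\<close>. The general share bound yields nothing below
  2, too weak in column 2.\<close>

lemma gap_2_ge:
  assumes "5 \<le> d"
  shows "5 * (d + 1) * gap d 1 \<le> 2 * gap d 2"
  using assms
proof (induction d rule: nat_induct_at_least)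
  case base
  show ?case using gap_values by simp
next
  case (Suc d)
  define a b where "a = gap d 1" "b = gap d 2"
  note defs = this
  have s: "d + 2 \<le> a" using gap_1_ge[of d] Suc.hyps by (simp add: defs)
  define p q where "p = d * a" "q = d * d"
  note pq = this
  have "(d + 2) * (d + 2) \<le> a * (d + 2)"
    using s by (rule mult_right_mono) simp
  then have 1: "q + 4 * d + 4 \<le> p + 2 * a"
    by (simp add: pq algebra_simps)
  have 2: "5 * p + 5 * a \<le> 2 * b"
    using Suc.IH by (simp add: defs pq algebra_simps)
  have 3: "5 * a \<le> p"
    unfolding pq using Suc.hyps by (rule mult_right_mono) simp
  have eqs: "5 * (Suc d + 1) * (2 * a + (d + 2)) = 10 * p + 20 * a + 5 * q + 20 * d + 20"
    "2 * (3 * b + (d + 2) * (2 * a + (d + 2))) = 6 * b + 4 * p + 8 * a + 2 * q + 8 * d + 8"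
    by (simp_all add: pq algebra_simps)
  have "5 * (Suc d + 1) * (2 * a + (d + 2)) \<le> 2 * (3 * b + (d + 2) * (2 * a + (d + 2)))"
    unfolding eqs using 1 2 3 by linarith
  then show ?case
    using Suc.hyps by (simp add: gap_Suc_1 gap_Suc_2 defs del: One_nat_def)
qed

section \<open>Induction over all columns\<close>

text \<open>This implies the numerical condition for \<open>\<nu> = 3\<close> and
  \<open>D0 = 14\<close> in all columns from 10 on. As the power tends to
  \<open>exp (- 22 / 7)\<close>, the linear factor eventually dominates.\<close>

lemma growth_number_bound:
  assumes "10 \<le> k"
  shows "1 \<le> 3 * (real k + 1) * (1 - (22 / 7) / (real k + 1)) ^ k"
  using assms
proof (induction k rule: nat_induct_at_least)
  case base
  show ?case by (simp add: power_divide)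
next
  case (Suc k)
  define x X :: real where "x = real k" "X = 22 / 7"
  note defs = this
  define a b where "a = 1 - X / (x + 1)" "b = 1 - X / (x + 2)"
  note ab = this
  define u where "u = x + 1 - X"
  have x: "10 \<le> x" using Suc.hyps by (simp add: defs)
  have u: "0 < u" "x + 1 = u + X" using x by (auto simp: u_def defs)
  have a: "0 < a" "a = u / (x + 1)" using x by (auto simp: ab u_def defs field_simps)
  \<comment> \<open>The base grows by a factor close to 1, whose \<open>k\<close>-th power
    Bernoulli's inequality estimates.\<close>
  have "b = a * (1 + X / ((x + 2) * u))"
  proof -
    have "u * (1 + X / ((x + 2) * u)) = u + X / (x + 2)"
      using u(1) by (simp add: distrib_left)
    then have "a * (1 + X / ((x + 2) * u)) = (u + X / (x + 2)) / (x + 1)"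
      by (simp add: a(2))
    also have "\<dots> = b"
      using x by (simp add: u_def ab divide_simps) (simp add: algebra_simps)
    finally show ?thesis by simp
  qed
  then have "b ^ k = a ^ k * (1 + X / ((x + 2) * u)) ^ k"
    by (simp add: power_mult_distrib)
  moreover have "1 + x * (X / ((x + 2) * u)) \<le> (1 + X / ((x + 2) * u)) ^ k"
  proof -
    have "0 \<le> X / ((x + 2) * u)" using x u by (simp add: defs)
    then show ?thesis
      using Bernoulli_inequality[of "X / ((x + 2) * u)" k] unfolding defs(1)[symmetric] by linarith
  qed
  ultimately have bk: "a ^ k * (1 + x * (X / ((x + 2) * u))) \<le> b ^ k"
    using mult_left_mono[of "1 + x * (X / ((x + 2) * u))" _ "a ^ k"] a by simp
  \<comment> \<open>Since \<open>u + 1 = (x + 2) * b\<close>, this says that the gain in the power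
    outweighs the additional factor \<open>b\<close>.\<close>
  have key: "x + 1 \<le> (u + 1) * (1 + x * (X / ((x + 2) * u)))"
  proof -
    have "(x + 1) * ((x + 2) * u) \<le> (u + 1) * ((x + 2) * u + x * X)"
    proof -
      have "(u + 1) * ((x + 2) * u + x * X) - (x + 1) * ((x + 2) * u) = u * (x + 2 - 2 * X) + x * X"
        by (simp add: u_def algebra_simps)
      moreover have "0 \<le> u * (x + 2 - 2 * X)" "0 \<le> x * X"
        using u x by (auto simp: defs)
      ultimately show ?thesis by simp
    qed
    moreover define q where "q = (x + 2) * u"
    moreover have "0 < q" using u x by (simp add: q_def)
    ultimately have "x + 1 \<le> (u + 1) * (q + x * X) / q"
      by (simp add: pos_le_divide_eq)
    moreover have "(q + x * X) / q = 1 + x * (X / q)"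
      using \<open>0 < q\<close> by (simp add: add_divide_distrib)
    ultimately show ?thesis
      by (simp add: q_def flip: times_divide_eq_right)
  qed
  have "(x + 1) * a ^ k \<le> (u + 1) * (1 + x * (X / ((x + 2) * u))) * a ^ k"
    using key a by (intro mult_right_mono) auto
  also have "\<dots> \<le> (u + 1) * b ^ k"
    using mult_left_mono[OF bk, of "u + 1"] u by (simp add: mult_ac)
  also have "u + 1 = (x + 2) * b"
    using x by (simp add: u_def ab field_simps)
  finally have "(x + 1) * a ^ k \<le> (x + 2) * b * b ^ k" .
  moreover have "1 \<le> 3 * ((x + 1) * a ^ k)"
    using Suc.IH unfolding defs ab by (simp only: mult.assoc)
  ultimately have "1 \<le> 3 * ((x + 2) * b * b ^ k)"
    by linarith
  moreover have "real (Suc k) + 1 = x + 2" by (simp add: defs)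
  moreover have "b = 1 - (22 / 7) / (x + 2)" by (simp only: ab defs(2))
  ultimately show ?case
    by (simp only: power_Suc mult.assoc)
qed

text \<open>The share bound gives \<open>\<nu> = 2 + 2 / (j + 1)\<close>, decreasing in
  \<open>j\<close>, while \<open>d + 1 = k + 3 + j\<close> increases; so conditions checked at
  \<open>J\<close> serve all \<open>j \<ge> J\<close>.\<close>

lemma gap_growth_step_share:
  assumes k: "2 \<le> k" and d: "d = k + 2 + j" and J: "1 \<le> J" "J \<le> j"
    and IH: "gap_growth (d - 1) k" "gap_growth d (k - 1)"
    and pos: "0 < real k - (1 + 1 / (real k + 3 + real J)) * (1 + 2 / (real J + 1))"
    and num: "1 \<le> (2 + 2 / (real J + 1)) * (real k + 1) *
      ((real k + 1) * (real k - (1 + 1 / (real k + 3 + real J)) * (1 + 2 / (real J + 1))) /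
        (real k * (real k + 2))) ^ k"
    and w: "2 * (1 - 1 / (2 + 2 / (real J + 1))) * (2 + 1 / real k) +
      4 * (1 - 1 / (2 + 2 / (real J + 1)))\<^sup>2 * (real k + 1) / (real k * (real k + 3 + real J)) \<le> 3"
  shows "gap_growth d k"
proof (rule gap_growth_step[OF k _ IH])
  let ?\<nu> = "2 + 2 / (real J + 1)" and ?D = "real k + 3 + real J"
  show "k + 2 < d" using d J by simp
  show "1 \<le> ?\<nu>" "2 \<le> ?D" by simp_all
  show "?D \<le> real d + 1" using d J by simp
  show "0 < real k - (1 + 1 / ?D) * (?\<nu> - 1)" "1 \<le> ?\<nu> * (real k + 1) *
      ((real k + 1) * (real k - (1 + 1 / ?D) * (?\<nu> - 1)) / (real k * (real k + 2))) ^ k"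
    using pos num by simp_all
  show "2 * (1 - 1 / ?\<nu>) * (2 + 1 / real k) + 4 * (1 - 1 / ?\<nu>)\<^sup>2 * (real k + 1) / (real k * ?D) \<le> 3"
    by (rule w)
  have "(real j + 1) * real (gap d k) \<le> (2 * real j + 4) * ((real k + 1) * real (gap (d - 1) k))"
    by (rule gap_share[OF d])
  then have "real (gap d k) \<le> (2 * real j + 4) / (real j + 1) * ((real k + 1) * real (gap (d - 1) k))"
    by (simp add: field_simps)
  also have "(2 * real j + 4) / (real j + 1) = 2 + 2 / (real j + 1)"
    by (simp add: field_simps)
  also have "(2 + 2 / (real j + 1)) * ((real k + 1) * real (gap (d - 1) k)) \<le>
      ?\<nu> * ((real k + 1) * real (gap (d - 1) k))"
    using J by (intro mult_right_mono add_mono divide_left_mono) auto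
  finally show "real (gap d k) \<le> ?\<nu> * ((real k + 1) * real (gap (d - 1) k))" .
qed

text \<open>At \<open>d = k + 2\<close> the first summand for \<open>gap d (k + 1)\<close> vanishes,
  so the ratio of neighbours is exactly \<open>k + 3\<close>, and \<open>gap_ratio_ge\<close> makes
  the preceding ratio at least \<open>4 / 3\<close> of it.\<close>

lemma gap_growth_boundary:
  assumes k: "5 \<le> k" and IH: "gap_growth (k + 2) (k - 1)"
  shows "gap_growth (k + 2) k"
proof -
  define D where "D = real k + 3"
  define R where "R = real (gap (k + 2) k) / real (gap (k + 2) (k - 1))"
  have g: "0 < real (gap (k + 2) (k - 1))" "0 < real (gap (k + 2) k)"
    using gap_pos[of "k - 1" "k + 2"] gap_pos[of k "k + 2"] by simp_all
  have kk: "k - 1 + 1 + 2 = k + 2" "Suc (k - 1) = k" using k by auto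
  have "4 * D * real (gap (k + 2) (k - 1)) \<le> 3 * real (gap (k + 2) k)"
    using gap_ratio_ge[of "k - 1" 2, unfolded kk] k by (simp add: D_def of_nat_diff algebra_simps)
  then have R: "4 * D / 3 \<le> R"
    using g by (simp add: R_def field_simps)
  have D: "8 \<le> D" using k by (simp add: D_def)
  have R1: "4 \<le> R" using R D by simp
  have "gap (k + 2) (Suc k) = (k + 3) * gap (k + 2) k"
    by (simp add: gap.simps(2)[of "Suc (Suc k)" k] gap.simps(2)[of "Suc k" k] algebra_simps)
  then have ratio: "real (gap (k + 2) (k + 1)) / real (gap (k + 2) k) = D"
    using g by (simp add: D_def)
  have "(real k + 1) * (D + 2) \<le> (R + 2) * (real k - 2 / R)"
  proof -
    have "(R + 2) * (real k - 2 / R) = real k * R + 2 * real k - 2 - 4 / R"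
      using R1 by (simp add: field_simps)
    moreover have "4 / R \<le> 1" using R1 by simp
    moreover have "4 / 3 * (real k * D) \<le> real k * R"
      using mult_left_mono[OF R, of "real k"] by simp
    moreover have "5 * D \<le> real k * D"
      using k D by (intro mult_right_mono) auto
    moreover have "(real k + 1) * (D + 2) = real k * D + 2 * real k + D + 2"
      by (simp add: algebra_simps)
    ultimately show ?thesis
      using D by linarith
  qed
  then have "((real k + 1) * (D + 2)) ^ k \<le> ((R + 2) * (real k - 2 / R)) ^ k"
    using D by (intro power_mono) auto
  also have "\<dots> \<le> real k * R * (real k * (R + 2)) ^ (k - 1)"
  proof (rule mean_power_bound)
    have "2 / R \<le> 1" using R1 by simp
    then show "2 / R \<le> real k" using k by simp
  qed (use R1 k in auto)
  also have "\<dots> \<le> fact k * real (gap (k + 2) k)"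
    unfolding R_def using IH k by (intro gap_growth_row) auto
  finally have "((real k + 1) * (D + 2)) ^ k \<le> fact k * real (gap (k + 2) k)" .
  moreover have "k < k + 2" by simp
  ultimately show ?thesis
    by (simp only: gap_growth_iff ratio)
qed

text \<open>The numerical hypotheses of the step lemmas fail for small \<open>k\<close> as long as \<open>d - k\<close> is small;
  those cases come from the table.\<close>

lemma gap_growth_Suc:
  assumes k: "2 \<le> k" and d: "k + 2 \<le> d" and IH: "gap_growth d k" "gap_growth (Suc d) (k - 1)"
  shows "gap_growth (Suc d) k"
proof -
  \<comment> \<open>\<open>j\<close> counts from \<open>k + 2\<close>, the offsets of the table from
    \<open>k + 1\<close>; hence the shift by one in the table cases.\<close>
  define j where "j = Suc d - (k + 2)"
  have j: "Suc d = k + 2 + j" "1 \<le> j" "Suc d = k + 1 + (j + 1)"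
    using d by (auto simp: j_def)
  have IH': "gap_growth (Suc d - 1) k" using IH by simp
  note step = gap_growth_step_share[OF k j(1) _ _ IH' IH(2)]
  consider "k = 2" | "k = 3" | "k = 4" | "k = 5" | "k = 6" | "k = 7" | "k = 8" | "k = 9" | "10 \<le> k"
    using k by linarith
  then show ?thesis
  proof cases
    case 1
    show ?thesis
    proof (rule gap_growth_step[OF k _ IH' IH(2), where \<nu> = "5 / 3" and ?D0.0 = 6])
      have "5 * (real d + 2) * real (gap (Suc d) 1) \<le> 2 * real (gap (Suc d) 2)"
      proof -
        have "real (5 * (Suc d + 1) * gap (Suc d) 1) \<le> real (2 * gap (Suc d) 2)"
          unfolding of_nat_le_iff using d 1 by (intro gap_2_ge) simp
        then show ?thesis by (simp add: algebra_simps)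
      qed
      then show "real (gap (Suc d) k) \<le> 5 / 3 * ((real k + 1) * real (gap (Suc d - 1) k))"
        using gap_Suc_2[of d] d 1 by (simp add: algebra_simps)
    qed (use d 1 in \<open>auto simp: power2_eq_square\<close>)
  next
    case 2
    show ?thesis
    proof (cases "j < 18")
      case True
      then show ?thesis
        unfolding j(3) using gap_growth_small[of k 1 19 "j + 1"] 2 by simp
    next
      case False
      then show ?thesis
        using 2 by (intro step[of 18]) (simp_all add: power_divide)
    qed
  next
    case 3
    show ?thesis
    proof (cases "j < 6")
      case True
      then show ?thesis
        unfolding j(3) using gap_growth_small[of k 1 7 "j + 1"] 3 by simp
    next
      case False
      then show ?thesis
        using 3 by (intro step[of 6]) (simp_all add: power_divide)
    qed
  next
    case 4
    show ?thesis
    proof (cases "j < 4")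
      case True
      then show ?thesis
        unfolding j(3) using gap_growth_small[of k 2 5 "j + 1"] 4 j(2) by simp
    next
      case False
      then show ?thesis
        using 4 by (intro step[of 4]) (simp_all add: power_divide)
    qed
  next
    case 5
    show ?thesis
    proof (cases "j < 3")
      case True
      then show ?thesis
        unfolding j(3) using gap_growth_small[of k 2 4 "j + 1"] 5 j(2) by simp
    next
      case False
      then show ?thesis
        using 5 by (intro step[of 3]) (simp_all add: power_divide)
    qed
  next
    case 6
    show ?thesis
    proof (cases "j < 2")
      case True
      then show ?thesis
        unfolding j(3) using gap_growth_small[of k 2 3 "j + 1"] 6 j(2) by simp
    next
      case False
      then show ?thesis
        using 6 by (intro step[of 2]) (simp_all add: power_divide)
    qed
  next
    case 7
    show ?thesis
    proof (cases "j < 2")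
      case True
      then show ?thesis
        unfolding j(3) using gap_growth_small[of k 2 3 "j + 1"] 7 j(2) by simp
    next
      case False
      then show ?thesis
        using 7 by (intro step[of 2]) (simp_all add: power_divide)
    qed
  next
    case 8
    show ?thesis
      using 8 j(2) by (intro step[of 1]) (simp_all add: power_divide)
  next
    case 9
    define x where "x = real k"
    have x: "10 \<le> x" using 9 by (simp add: x_def)
    \<comment> \<open>From \<open>j \<ge> 1\<close> the factor \<open>(2 * j + 4) / (j + 1)\<close>
      is at most 3, and \<open>k \<ge> 10\<close> admits \<open>D0 = 14\<close>, so that
      \<open>(1 + 1 / D0) * (\<nu> - 1) = 15 / 7\<close>.\<close>
    show ?thesis
    proof (rule gap_growth_step[OF k _ IH' IH(2), where \<nu> = 3 and ?D0.0 = 14])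
      have "(real j + 1) * real (gap (Suc d) k) \<le> (2 * real j + 4) * ((real k + 1) * real (gap (Suc d - 1) k))"
        by (rule gap_share[OF j(1)])
      also have "\<dots> \<le> (3 * (real j + 1)) * ((real k + 1) * real (gap (Suc d - 1) k))"
        using j(2) by (intro mult_right_mono) auto
      finally have "(real j + 1) * real (gap (Suc d) k) \<le>
          (real j + 1) * (3 * ((real k + 1) * real (gap (Suc d - 1) k)))"
        by (simp only: mult_ac)
      then show "real (gap (Suc d) k) \<le> 3 * ((real k + 1) * real (gap (Suc d - 1) k))"
        by (simp only: mult_le_cancel_left_pos)
      show "1 \<le> 3 * (real k + 1) *
          ((real k + 1) * (real k - (1 + 1 / 14) * (3 - 1)) / (real k * (real k + 2))) ^ k"
      proof -
        have "1 - (22 / 7) / (x + 1) = (x - 15 / 7) * (1 / (x + 1))"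
          using x by (simp add: field_simps)
        also have "\<dots> \<le> (x - 15 / 7) * ((x + 1) / (x * (x + 2)))"
        proof (rule mult_left_mono)
          show "1 / (x + 1) \<le> (x + 1) / (x * (x + 2))"
            using x by (simp add: divide_simps) (simp add: algebra_simps)
        qed (use x in simp)
        finally have "1 - (22 / 7) / (x + 1) \<le> (x + 1) * (x - 15 / 7) / (x * (x + 2))"
          by (simp add: mult_ac)
        then have "3 * (x + 1) * (1 - (22 / 7) / (x + 1)) ^ k \<le>
            3 * (x + 1) * ((x + 1) * (x - 15 / 7) / (x * (x + 2))) ^ k"
          using x by (intro mult_left_mono power_mono) (auto simp: field_simps)
        moreover have "(1 + 1 / 14) * (3 - 1) = (15 / 7 :: real)" by simp
        ultimately show ?thesis
          using growth_number_bound[OF 9] unfolding x_def by (simp only:)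
      qed
      show "2 * (1 - 1 / 3) * (2 + 1 / real k) + 4 * (1 - 1 / 3)\<^sup>2 * (real k + 1) / (real k * 14) \<le> 3"
        using x unfolding x_def[symmetric] by (simp add: field_simps power2_eq_square)
    qed (use d 9 in auto)
  qed
qed

text \<open>Outer induction on \<open>k\<close>, inner on \<open>d\<close>. The start
  \<open>d = k + 2\<close> comes from the table up to column 4 and from
  \<open>gap_growth_boundary\<close> afterwards.\<close>

lemma gap_growth:
  assumes "2 \<le> k" "k + 2 \<le> d"
  shows "gap_growth d k"
  using assms
proof (induction k arbitrary: d rule: nat_induct_at_least)
  case base
  then show ?case
  proof (induction d rule: nat_induct_at_least)
    case base
    show ?case using gap_growth_small[of 2 1 2 1] by (simp add: eval_nat_numeral)
  next
    case (Suc d)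
    then show ?case
      using gap_growth_1[of "Suc d"] by (auto intro!: gap_growth_Suc[of 2 d])
  qed
next
  case (Suc k)
  have prev: "gap_growth d k" if "Suc k + 2 \<le> d" for d
    using that by (intro Suc.IH) simp
  from Suc.prems show ?case
  proof (induction d rule: nat_induct_at_least)
    case base
    consider "Suc k = 3" | "Suc k = 4" | "5 \<le> Suc k"
      using Suc.hyps by linarith
    then show ?case
    proof cases
      case 1
      then show ?thesis using gap_growth_small[of "Suc k" 1 19 1] by simp
    next
      case 2
      then show ?thesis using gap_growth_small[of "Suc k" 1 7 1] by simp
    next
      case 3
      then show ?thesis using prev[of "Suc k + 2"] by (intro gap_growth_boundary) simp_all
    qed
  next
    case (Suc d)
    then show ?case
      using prev[of "Suc d"] \<open>2 \<le> k\<close> by (intro gap_growth_Suc[of "Suc k" d]) simp_all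
  qed
qed

section \<open>Comparison with binomial coefficients\<close>

lemma ex_binomial_bracket:
  assumes "0 < k" "0 < m"
  shows "\<exists>a. a choose k \<le> m \<and> m < Suc a choose k"
proof -
  have "m < Suc (m + k) choose k"
  proof -
    have "m + k choose k \<ge> m + 1"
    proof (induction m)
      case (Suc m)
      obtain l where k: "k = Suc l" using assms(1) by (cases k) auto
      have "0 < (m + k) choose l" using k by (intro zero_less_binomial) simp
      moreover have "Suc m + k choose k = ((m + k) choose l) + ((m + k) choose k)"
        by (simp add: k)
      ultimately show ?case using Suc.IH by linarith
    qed simp
    then show ?thesis
      using binomial_right_mono[of "m + k" "Suc (m + k)" k] by linarith
  qed
  define a where "a = (LEAST a. m < Suc a choose k)"
  have "m < Suc a choose k"
    unfolding a_def by (rule LeastI) fact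
  moreover have "a choose k \<le> m"
  proof (cases a)
    case 0
    then show ?thesis using assms by (cases k) auto
  next
    case (Suc b)
    then have "\<not> m < Suc b choose k"
      using not_less_Least[of b "\<lambda>a. m < Suc a choose k"] by (simp add: a_def)
    then show ?thesis using Suc by simp
  qed
  ultimately show ?thesis by blast
qed

text \<open>Let \<open>a\<close> be largest with \<open>a choose k \<le> gap d k\<close>. Then
  \<open>k! * gap d k < (a + 1) ^ k\<close>, so growth bounds the ratio \<open>R\<close> by
  \<open>(k + 1) * R \<le> a - 2 * k - 1\<close>, and
  \<open>(k + 1) * (a choose (k + 1)) = (a - k) * (a choose k)\<close> finishes. In column 1,
  \<open>a = gap d 1\<close> is exact.\<close>

lemma gap_binomial:
  assumes "1 \<le> k" "k + 2 \<le> d"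
  shows "\<exists>a. a choose k \<le> gap d k \<and> gap d (Suc k) \<le> a choose Suc k"
proof (cases "k = 1")
  case True
  \<comment> \<open>At \<open>d = 3\<close> growth fails, but this bound still holds:
    \<open>40 \<le> 45\<close>.\<close>
  have "gap d 2 \<le> gap d 1 choose 2"
  proof (cases "d = 3")
    case True
    then show ?thesis by (simp add: gap_values choose_two del: One_nat_def)
  next
    case False
    then have "2 * gap d 2 + 4 * gap d 1 \<le> gap d 1 * gap d 1"
      using gap_growth_1[of d] assms True unfolding gap_growth_1_iff by simp
    then have "2 * gap d 2 \<le> gap d 1 * (gap d 1 - 1)"
      by (simp add: diff_mult_distrib2)
    then show ?thesis by (simp add: choose_two)
  qed
  then show ?thesis
    using True by (intro exI[of _ "gap d 1"]) (simp add: numeral_2_eq_2)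
next
  case False
  then have k: "2 \<le> k" using assms by simp
  have "0 < gap d k" using gap_pos[of k d] assms by simp
  then obtain a where a: "a choose k \<le> gap d k" "gap d k < Suc a choose k"
    using ex_binomial_bracket[of k "gap d k"] k by auto
  define m R x c b where "m = real (gap d k)" "R = real (gap d (k + 1)) / m" "x = real k"
    "c = real (a choose k)" "b = real a"
  note defs = this
  have m: "0 < m" using \<open>0 < gap d k\<close> by (simp add: defs)
  have "((x + 1) * (R + 2)) ^ k \<le> fact k * m"
    using gap_growth[OF k assms(2)] assms unfolding defs by (subst (asm) gap_growth_iff) auto
  also have "\<dots> < fact k * real (Suc a choose k)"
    using a(2) by (simp add: defs)
  also have "\<dots> \<le> (b + 1) ^ k"
  proof -
    have "(Suc a choose k) * fact k \<le> Suc a ^ k" by (rule binomial_fact_pow)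
    then have "real ((Suc a choose k) * fact k) \<le> real (Suc a ^ k)"
      by (simp only: of_nat_le_iff)
    then show ?thesis by (simp add: defs mult.commute add.commute)
  qed
  finally have "(x + 1) * (R + 2) < b + 1"
    by (rule power_less_imp_less_base) (simp add: defs)
  then have Rb: "(x + 1) * R \<le> b - 2 * x - 1" by (simp add: algebra_simps)
  have "0 \<le> (x + 1) * R" by (simp add: defs)
  then have ba: "2 * x + 1 \<le> b" using Rb by linarith
  have ak: "2 * k + 1 \<le> a" using ba by (simp add: defs)
  have "(b + 1 - x) * m \<le> (b + 1) * c"
  proof -
    have "(Suc a - k) * (Suc a choose k) = Suc a * (a choose k)"
      using binomial_absorb_comp[of "Suc a" k] by simp
    then have "real (Suc a - k) * real (Suc a choose k) = real (Suc a) * real (a choose k)"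
      by (simp only: of_nat_mult[symmetric])
    moreover have "real (Suc a - k) = b + 1 - x" using ak by (simp add: defs of_nat_diff)
    moreover have "real (Suc a) = b + 1" by (simp add: defs)
    ultimately have "(b + 1 - x) * real (Suc a choose k) = (b + 1) * c"
      by (simp only: defs(4))
    moreover have "(b + 1 - x) * m \<le> (b + 1 - x) * real (Suc a choose k)"
      using a(2) ba by (intro mult_left_mono) (auto simp: defs)
    ultimately show ?thesis by simp
  qed
  then have "(b - 2 * x) * ((b + 1 - x) * m) \<le> (b - 2 * x) * ((b + 1) * c)"
    using ba by (intro mult_left_mono) auto
  also have "\<dots> \<le> (b - x) * (b + 1 - x) * c"
  proof -
    \<comment> \<open>The spare \<open>x\<close> in \<open>b - 2 * x\<close> pays for replacing
      \<open>a + 1\<close> by \<open>a\<close> in the binomial.\<close>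
    have "(b - 2 * x) * (b + 1) \<le> (b - x) * (b + 1 - x)"
      by (simp add: algebra_simps defs)
    then show ?thesis
      using mult_right_mono[of "(b - 2 * x) * (b + 1)" "(b - x) * (b + 1 - x)" c] by (simp add: defs mult_ac)
  qed
  finally have "(b + 1 - x) * ((b - 2 * x) * m) \<le> (b + 1 - x) * ((b - x) * c)"
    by (simp only: mult_ac)
  then have 1: "(b - 2 * x) * m \<le> (b - x) * c"
    using ba by (simp add: mult_le_cancel_left_pos defs)
  have "(x + 1) * real (gap d (k + 1)) = (x + 1) * R * m"
    using m by (simp add: defs(2))
  also have "\<dots> \<le> (b - 2 * x) * m"
    using Rb m by (intro mult_right_mono) auto
  also note 1
  also have "(b - x) * c = (x + 1) * real (a choose Suc k)"
  proof -
    have "Suc k * (a choose Suc k) = (a - k) * (a choose k)"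
      using binomial_absorption[of k a] binomial_absorb_comp[of a k] by simp
    then have "real (Suc k) * real (a choose Suc k) = real (a - k) * real (a choose k)"
      by (simp only: of_nat_mult[symmetric])
    moreover have "real (a - k) = b - x" using ak by (simp add: defs of_nat_diff)
    moreover have "real (Suc k) = x + 1" by (simp add: defs)
    ultimately show ?thesis by (simp only: defs(4))
  qed
  finally have "real (gap d (k + 1)) \<le> real (a choose Suc k)"
    by (simp add: mult_le_cancel_left_pos defs)
  then show ?thesis
    using a(1) by auto
qed

section \<open>Colexicographic rank of multisets\<close>

text \<open>The number of multisets of the same size that precede \<open>M\<close> colexicographically.\<close>

function mrank :: "nat multiset \<Rightarrow> nat" where
  "mrank M = (if M = {#} then 0
     else ((Max_mset M + size M - 1) choose size M) + mrank (M - {#Max_mset M#}))"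
  by auto
termination
  by (relation "measure size") (auto intro!: size_Diff1_less Max_in)

declare mrank.simps [simp del]

lemma mrank_empty [simp]: "mrank {#} = 0"
  by (simp add: mrank.simps)

lemma mrank_add_max:
  assumes "\<forall>y\<in>#M. y \<le> x"
  shows "mrank (add_mset x M) = ((x + size M) choose Suc (size M)) + mrank M"
proof -
  have "Max_mset (add_mset x M) = x"
    using assms by (intro Max_eqI) auto
  then show ?thesis
    by (subst mrank.simps) simp
qed

text \<open>Multisets of this size with entries at most \<open>v\<close> form an initial segment,
  whose length is this binomial; the induction is Pascal's rule.\<close>

lemma mrank_less:
  assumes "\<forall>y\<in>#M. y \<le> v"
  shows "mrank M < (v + size M) choose size M"
  using assms
proof (induction M arbitrary: v rule: multiset_induct_max)
  case empty
  show ?case by simp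
next
  case (add x M)
  have "mrank M < (x + size M) choose size M"
    using add by blast
  then have "mrank (add_mset x M) < ((x + size M) choose Suc (size M)) + ((x + size M) choose size M)"
    using add by (subst mrank_add_max) auto
  also have "\<dots> = (x + size (add_mset x M)) choose size (add_mset x M)"
    by simp
  also have "\<dots> \<le> (v + size (add_mset x M)) choose size (add_mset x M)"
    using add.prems by (intro binomial_right_mono) simp
  finally show ?case .
qed

lemma mrank_add_ge: "mrank M \<le> mrank (add_mset x M)"
proof (induction M rule: multiset_induct_max)
  case empty
  show ?case by simp
next
  case (add y M)
  show ?case
  proof (cases "y \<le> x")
    case True
    then have "\<forall>z\<in>#add_mset y M. z \<le> x"
      using add by auto
    then show ?thesis
      using mrank_add_max[of "add_mset y M" x] by simp
  next
    case False
    have "mrank (add_mset x (add_mset y M)) = mrank (add_mset y (add_mset x M))"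
      by (simp add: add_mset_commute)
    also have "\<dots> = ((y + size (add_mset x M)) choose Suc (size (add_mset x M))) + mrank (add_mset x M)"
      using False add by (intro mrank_add_max) auto
    also have "\<dots> \<ge> ((y + size M) choose Suc (size M)) + mrank M"
      using add.IH by (intro add_mono) simp_all
    finally show ?thesis
      using add by (simp add: mrank_add_max)
  qed
qed

text \<open>If \<open>v \<le> x\<close>, the term of the new maximum \<open>x\<close> suffices.
  Otherwise \<open>v\<close> stays the maximum of a larger multiset, and by Pascal's rule its term
  grows by exactly the stated binomial.\<close>

lemma mrank_add_ge_binomial:
  assumes "v \<in># M" "\<forall>y\<in>#M. y \<le> v"
  shows "mrank M + ((v + size M - 1) choose Suc (size M)) \<le> mrank (add_mset x M)"
proof -
  obtain N where N: "M = add_mset v N"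
    using assms(1) by (metis insert_DiffM)
  let ?k = "size N"
  show ?thesis
  proof (cases "v \<le> x")
    case True
    then have "\<forall>y\<in>#M. y \<le> x"
      using assms by auto
    then have "mrank (add_mset x M) = ((x + size M) choose Suc (size M)) + mrank M"
      by (rule mrank_add_max)
    moreover have "(v + size M - 1) choose Suc (size M) \<le> (x + size M) choose Suc (size M)"
      using True by (intro binomial_right_mono) simp
    ultimately show ?thesis by simp
  next
    case False
    have "mrank (add_mset x M) = mrank (add_mset v (add_mset x N))"
      by (simp add: N add_mset_commute)
    also have "\<dots> = ((v + Suc ?k) choose Suc (Suc ?k)) + mrank (add_mset x N)"
      using False assms N by (subst mrank_add_max) auto
    also have "\<dots> \<ge> ((v + Suc ?k) choose Suc (Suc ?k)) + mrank N"
      using mrank_add_ge by simp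
    finally have *: "((v + Suc ?k) choose Suc (Suc ?k)) + mrank N \<le> mrank (add_mset x M)" .
    have "mrank M = ((v + ?k) choose Suc ?k) + mrank N"
      using assms unfolding N by (subst mrank_add_max) auto
    then show ?thesis
      using * by (simp add: N)
  qed
qed

lemma ex_max_decomposition:
  fixes M :: "nat multiset"
  assumes "M \<noteq> {#}"
  obtains v N where "M = add_mset v N" "\<forall>y\<in>#N. y \<le> v"
proof
  show "M = add_mset (Max_mset M) (M - {#Max_mset M#})"
    using assms by (simp add: Max_in)
  show "\<forall>y\<in>#M - {#Max_mset M#}. y \<le> Max_mset M"
    using in_diffD by fastforce
qed

text \<open>The ranks of multisets with a given maximum lie in an interval between consecutive
  binomials, so the rank determines the maximum.\<close>

lemma mrank_inj:
  assumes "size M = size N" "mrank M = mrank N"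
  shows "M = N"
  using assms
proof (induction M arbitrary: N rule: multiset_induct_max)
  case empty
  then show ?case by simp
next
  case (add x M)
  have "N \<noteq> {#}"
    using add.prems by auto
  then obtain y N' where N: "N = add_mset y N'" "\<forall>z\<in>#N'. z \<le> y"
    by (rule ex_max_decomposition)
  let ?k = "size M"
  have sz: "size N' = ?k"
    using add.prems N by simp
  have 1: "(x + ?k) choose Suc ?k \<le> mrank (add_mset x M)"
    "mrank (add_mset x M) < (Suc x + ?k) choose Suc ?k"
    using mrank_less[of "add_mset x M" x] add(1,2) by (auto simp: mrank_add_max)
  have 2: "(y + ?k) choose Suc ?k \<le> mrank N" "mrank N < (Suc y + ?k) choose Suc ?k"
    using mrank_less[of N y] N sz by (auto simp: mrank_add_max)
  have "\<not> x < y"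
  proof
    assume "x < y"
    then have "(Suc x + ?k) choose Suc ?k \<le> (y + ?k) choose Suc ?k"
      by (intro binomial_right_mono) simp
    then show False
      using 1 2 add.prems by simp
  qed
  moreover have "\<not> y < x"
  proof
    assume "y < x"
    then have "(Suc y + ?k) choose Suc ?k \<le> (x + ?k) choose Suc ?k"
      by (intro binomial_right_mono) simp
    then show False
      using 1 2 add.prems by simp
  qed
  ultimately have xy: "x = y" by simp
  have "mrank M = mrank N'"
    using add.prems add(1,2) N xy sz by (simp add: mrank_add_max)
  then show ?case
    using add.IH[of N'] sz N xy by simp
qed

text \<open>Greedy expansion: after splitting off the largest \<open>v\<close> whose term fits, the
  remainder is below \<open>(v + k) choose k\<close>, which forces the other entries to be at most
  \<open>v\<close>.\<close>

lemma mrank_surj: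
  assumes "k \<ge> 1"
  shows "\<exists>M. size M = k \<and> mrank M = r"
  using assms
proof (induction k arbitrary: r rule: nat_induct_at_least)
  case base
  have "mrank {#r#} = r"
    using mrank_add_max[of "{#}" r] by simp
  then show ?case
    by (intro exI[of _ "{#r#}"]) simp
next
  case (Suc k)
  let ?c = "\<lambda>v. (v + k) choose Suc k"
  have ge: "v \<le> ?c v" for v
  proof (induction v)
    case (Suc v)
    have "?c (Suc v) = ((v + k) choose k) + ?c v" by simp
    moreover have "(v + k) choose k \<ge> 1"
      using zero_less_binomial[of k "v + k"] by linarith
    ultimately show ?case
      using Suc.IH by linarith
  qed simp
  define v where "v = (LEAST v. r < ?c (Suc v))"
  have "r < ?c (Suc r)"
    using ge[of "Suc r"] by simp
  then have v1: "r < ?c (Suc v)"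
    unfolding v_def by (rule LeastI)
  have v2: "?c v \<le> r"
  proof (cases v)
    case (Suc u)
    then have "\<not> r < ?c (Suc u)"
      using not_less_Least[of u "\<lambda>v. r < ?c (Suc v)"] by (simp add: v_def)
    then show ?thesis
      using Suc by simp
  qed (simp add: binomial_eq_0)
  obtain M where M: "size M = k" "mrank M = r - ?c v"
    using Suc.IH by blast
  have r': "mrank M < (v + k) choose k"
    using v1 v2 M by simp
  have "\<forall>y\<in>#M. y \<le> v"
  proof -
    have "M \<noteq> {#}"
      using M Suc.hyps by auto
    then obtain u N where N: "M = add_mset u N" "\<forall>z\<in>#N. z \<le> u"
      by (rule ex_max_decomposition)
    have "u \<le> v"
    proof (rule ccontr)
      assume "\<not> u \<le> v"
      moreover have k: "k = Suc (size N)"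
        using M N by simp
      ultimately have "v + k \<le> u + size N" by simp
      then have "(v + k) choose k \<le> (u + size N) choose Suc (size N)"
        unfolding k by (rule binomial_right_mono)
      also have "\<dots> \<le> mrank M"
        using N by (simp add: mrank_add_max)
      finally show False
        using r' by simp
    qed
    then show ?thesis
      using N by auto
  qed
  then have "mrank (add_mset v M) = r"
    using M v2 by (simp add: mrank_add_max)
  then show ?case
    using M by (intro exI[of _ "add_mset v M"]) simp
qed

lemma card_mrank_less:
  assumes "k \<ge> 1 \<or> r \<le> 1"
  shows "finite {M. size M = k \<and> mrank M < r}" "card {M. size M = k \<and> mrank M < r} = r"
proof -
  let ?S = "{M. size M = k \<and> mrank M < r}"
  have "bij_betw mrank ?S {..<r}"
  proof (rule bij_betw_imageI)
    show "inj_on mrank ?S"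
      by (intro inj_onI) (auto intro: mrank_inj)
    show "mrank ` ?S = {..<r}"
    proof
      show "{..<r} \<subseteq> mrank ` ?S"
      proof
        fix s assume s: "s \<in> {..<r}"
        have "\<exists>M. size M = k \<and> mrank M = s"
        proof (cases "k \<ge> 1")
          case False
          then show ?thesis
            using s assms by (intro exI[of _ "{#}"]) auto
        qed (rule mrank_surj)
        then show "s \<in> mrank ` ?S"
          using s by auto
      qed
    qed auto
  qed
  then show "finite ?S" "card ?S = r"
    using bij_betw_finite[of mrank ?S "{..<r}"] bij_betw_same_card[of mrank ?S "{..<r}"] by simp_all
qed

section \<open>Order ideals of monomials\<close>

text \<open>Degree becomes size, and divisibility becomes inclusion of multisets.\<close>

definition exponent_mset :: "(nat \<Rightarrow>\<^sub>0 nat) \<Rightarrow> nat multiset" where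
  "exponent_mset m = Abs_multiset (Poly_Mapping.lookup m)"

lemma count_exponent_mset: "count (exponent_mset m) = Poly_Mapping.lookup m"
  unfolding exponent_mset_def
  by (rule count_Abs_multiset) (simp flip: neq0_conv)

lemma set_exponent_mset: "set_mset (exponent_mset m) = Poly_Mapping.keys m"
  by (auto simp: set_mset_def count_exponent_mset in_keys_iff)

lemma size_exponent_mset: "size (exponent_mset m) = mono_deg m"
  by (simp add: size_multiset_overloaded_eq mono_deg_def set_exponent_mset count_exponent_mset)

lemma exponent_mset_add: "exponent_mset (a + b) = exponent_mset a + exponent_mset b"
  by (rule multiset_eqI) (simp add: count_exponent_mset lookup_add)

lemma bij_exponent_mset: "bij exponent_mset"
proof (rule bijI)
  show "inj exponent_mset"
    by (rule injI, rule poly_mapping_eqI) (metis count_exponent_mset)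
  show "surj exponent_mset"
  proof (rule surjI)
    fix M :: "nat multiset"
    have "finite {x. count M x \<noteq> 0}" by simp
    then show "exponent_mset (Abs_poly_mapping (count M)) = M"
      by (intro multiset_eqI) (simp add: count_exponent_mset)
  qed
qed

lemma lookup_homogeneous_component:
  "Poly_Mapping.lookup (homogeneous_component i p) m =
    (if mono_deg m = i then Poly_Mapping.lookup p m else 0)"
proof -
  let ?K = "{m. m \<in> Poly_Mapping.keys p \<and> mono_deg m = i}"
  have "Poly_Mapping.lookup (homogeneous_component i p) m =
      (\<Sum>a\<in>?K. if m = a then Poly_Mapping.lookup p m else 0)"
    by (auto simp: homogeneous_component_def lookup_sum lookup_single when_def intro!: sum.cong)
  also have "\<dots> = (if m \<in> ?K then Poly_Mapping.lookup p m else 0)"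
    by (subst sum.delta') auto
  also have "\<dots> = (if mono_deg m = i then Poly_Mapping.lookup p m else 0)"
    by (auto simp: in_keys_iff)
  finally show ?thesis .
qed

text \<open>The monomials outside \<open>Ms\<close> span an ideal because \<open>Ms\<close> is
  closed under division; those in \<open>Ms\<close> of degree \<open>i\<close> form a basis of the
  quotient, over any field.\<close>

lemma M_vector_order_ideal:
  fixes Ms :: "nat multiset set" and f :: "nat \<Rightarrow> int"
  assumes fin: "finite Ms"
    and closed: "\<And>M N. M \<in> Ms \<Longrightarrow> N \<subseteq># M \<Longrightarrow> N \<in> Ms"
    and f: "\<And>i. int (card {M \<in> Ms. size M = i}) = (if i \<le> d then f i else 0)"
  shows "M_vector TYPE('k::field) d f"
proof -
  have "finite (\<Union>M\<in>Ms. set_mset M)"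
    using fin by auto
  then obtain r where r: "(\<Union>M\<in>Ms. set_mset M) \<subseteq> {..<r}"
    using finite_nat_bounded by blast
  define I :: "'k mpoly set" where
    "I = {p \<in> mpoly_ring r. \<forall>m\<in>Poly_Mapping.keys p. exponent_mset m \<notin> Ms}"
  have I_iff: "p \<in> I \<longleftrightarrow> p \<in> mpoly_ring r \<and>
      (\<forall>m. exponent_mset m \<in> Ms \<longrightarrow> Poly_Mapping.lookup p m = 0)" for p
    by (auto simp: I_def in_keys_iff)
  have hom: "homogeneous_ideal r I"
    unfolding homogeneous_ideal_def
  proof (intro conjI ballI allI)
    show "I \<subseteq> mpoly_ring r" by (auto simp: I_def)
    show "0 \<in> I" by (simp add: I_def mpoly_ring_def)
  next
    fix p q assume pq: "p \<in> I" "q \<in> I"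
    have "Poly_Mapping.keys (p + q) \<subseteq> Poly_Mapping.keys p \<union> Poly_Mapping.keys q"
      by (rule Poly_Mapping.keys_add)
    then show "p + q \<in> I"
      using pq unfolding I_def mpoly_ring_def by blast
  next
    fix p q :: "'k mpoly" assume pq: "p \<in> mpoly_ring r" "q \<in> I"
    show "p * q \<in> I"
      unfolding I_def mpoly_ring_def
    proof (intro CollectI conjI ballI)
      fix m assume "m \<in> Poly_Mapping.keys (p * q)"
      then obtain a b where ab: "m = a + b" "a \<in> Poly_Mapping.keys p" "b \<in> Poly_Mapping.keys q"
        using keys_mult[of p q] by auto
      have "Poly_Mapping.keys m \<subseteq> Poly_Mapping.keys a \<union> Poly_Mapping.keys b"
        unfolding ab by (rule Poly_Mapping.keys_add)
      then show "Poly_Mapping.keys m \<subseteq> {..<r}"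
        using ab pq unfolding I_def mpoly_ring_def by blast
      have "exponent_mset b \<notin> Ms"
        using ab pq by (auto simp: I_def)
      then show "exponent_mset m \<notin> Ms"
        using closed[of "exponent_mset m" "exponent_mset b"] by (auto simp: ab exponent_mset_add)
    qed
  next
    fix p i assume p: "p \<in> I"
    then show "homogeneous_component i p \<in> I"
      unfolding I_def mpoly_ring_def
      by (auto simp: in_keys_iff lookup_homogeneous_component split: if_splits)
  qed
  have hilb: "hilbert_value r I i (card {M \<in> Ms. size M = i})" for i
  proof -
    define K where "K = {m. exponent_mset m \<in> Ms \<and> mono_deg m = i}"
    define B :: "'k mpoly set" where "B = (\<lambda>m. Poly_Mapping.single m 1) ` K"
    have bij: "bij_betw exponent_mset K {M \<in> Ms. size M = i}"
      unfolding bij_betw_def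
    proof
      show "inj_on exponent_mset K"
        using bij_exponent_mset by (meson bij_is_inj inj_on_subset subset_UNIV)
      show "exponent_mset ` K = {M \<in> Ms. size M = i}"
        using bij_is_surj[OF bij_exponent_mset]
        by (auto simp: K_def size_exponent_mset image_iff) (metis size_exponent_mset surjD)
    qed
    have finK: "finite K"
      using bij_betw_finite[OF bij] fin by simp
    have inj: "inj_on (\<lambda>m. Poly_Mapping.single m (1::'k)) K"
      by (rule inj_onI) (metis lookup_single_eq lookup_single_not_eq zero_neq_one)
    have cardB: "card B = card {M \<in> Ms. size M = i}"
      unfolding B_def using card_image[OF inj] bij_betw_same_card[OF bij] by simp
    have keysK: "Poly_Mapping.keys m \<subseteq> {..<r}" if "m \<in> K" for m
      using that r by (auto simp: K_def set_exponent_mset[symmetric])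
    have lk: "Poly_Mapping.lookup (\<Sum>b\<in>B. Poly_Mapping.single 0 (c b) * b) m =
        (if m \<in> K then c (Poly_Mapping.single m 1) else 0)" for c and m
    proof -
      have "(\<Sum>b\<in>B. Poly_Mapping.single 0 (c b) * b) =
          (\<Sum>a\<in>K. Poly_Mapping.single a (c (Poly_Mapping.single a 1)))"
        unfolding B_def by (subst sum.reindex[OF inj]) (simp add: mult_single)
      also have "Poly_Mapping.lookup \<dots> m =
          (\<Sum>a\<in>K. if m = a then c (Poly_Mapping.single m 1) else 0)"
        by (auto simp: lookup_sum lookup_single when_def intro!: sum.cong)
      also have "\<dots> = (if m \<in> K then c (Poly_Mapping.single m 1) else 0)"
        using finK by (subst sum.delta') auto
      finally show ?thesis .
    qed
    have "quotient_basis r I i B"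
      unfolding quotient_basis_def
    proof (intro conjI ballI)
      show "finite B" using finK by (simp add: B_def)
      show "B \<subseteq> mpoly_forms r i"
      proof
        fix b assume "b \<in> B"
        then obtain m where m: "m \<in> K" "b = Poly_Mapping.single m 1"
          by (auto simp: B_def)
        then have "mono_deg m = i"
          by (simp add: K_def)
        then show "b \<in> mpoly_forms r i"
          using keysK[OF m(1)] by (simp add: m mpoly_forms_def mpoly_ring_def)
      qed
    next
      fix p :: "'k mpoly" assume p: "p \<in> mpoly_forms r i"
      \<comment> \<open>Membership dictates every coefficient, which settles existence and
        uniqueness at once.\<close>
      have mem: "p - (\<Sum>b\<in>B. Poly_Mapping.single 0 (c b) * b) \<in> I \<longleftrightarrow>
          (\<forall>m\<in>K. c (Poly_Mapping.single m 1) = Poly_Mapping.lookup p m)" for c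
      proof -
        let ?q = "p - (\<Sum>b\<in>B. Poly_Mapping.single 0 (c b) * b)"
        have q: "Poly_Mapping.lookup ?q m =
            Poly_Mapping.lookup p m - (if m \<in> K then c (Poly_Mapping.single m 1) else 0)" for m
          by (simp add: lookup_minus lk)
        have "?q \<in> mpoly_ring r"
          unfolding mpoly_ring_def
        proof (intro CollectI ballI)
          fix m assume "m \<in> Poly_Mapping.keys ?q"
          then have "m \<in> Poly_Mapping.keys p \<or> m \<in> K"
            by (simp add: in_keys_iff q split: if_splits)
          then show "Poly_Mapping.keys m \<subseteq> {..<r}"
            using p keysK unfolding mpoly_forms_def mpoly_ring_def by blast
        qed
        moreover have "Poly_Mapping.lookup p m = 0" if "exponent_mset m \<in> Ms" "m \<notin> K" for m
          using that p by (auto simp: K_def mpoly_forms_def in_keys_iff)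
        moreover have "m \<in> K \<Longrightarrow> exponent_mset m \<in> Ms" for m
          by (simp add: K_def)
        ultimately show ?thesis
          unfolding I_iff q by fastforce
      qed
      show "\<exists>!c. c \<in> extensional B \<and> p - (\<Sum>b\<in>B. Poly_Mapping.single 0 (c b) * b) \<in> I"
      proof (rule ex1I)
        let ?c = "\<lambda>b\<in>B. Poly_Mapping.lookup p (inv_into K (\<lambda>m. Poly_Mapping.single m 1) b)"
        have "?c (Poly_Mapping.single m 1) = Poly_Mapping.lookup p m" if "m \<in> K" for m
          using that inv_into_f_f[OF inj that] by (simp add: B_def)
        then show "?c \<in> extensional B \<and> p - (\<Sum>b\<in>B. Poly_Mapping.single 0 (?c b) * b) \<in> I"
          unfolding mem by simp
        fix c assume c: "c \<in> extensional B \<and> p - (\<Sum>b\<in>B. Poly_Mapping.single 0 (c b) * b) \<in> I"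
        show "c = ?c"
        proof (rule extensionalityI[of _ B])
          fix b assume "b \<in> B"
          then obtain m where m: "m \<in> K" "b = Poly_Mapping.single m 1"
            by (auto simp: B_def)
          then show "c b = ?c b"
            using c inv_into_f_f[OF inj m(1)] \<open>b \<in> B\<close> unfolding mem by simp
        qed (use c in auto)
      qed
    qed
    then show ?thesis
      unfolding hilbert_value_def using cardB by blast
  qed
  show ?thesis
    unfolding M_vector_def using hom hilb f by blast
qed

text \<open>The empty order ideal, with quotient zero; it serves the edgeless graph, where all
  \<open>h_i\<close> vanish.\<close>

lemma M_vector_zero:
  assumes "\<And>i. i \<le> d \<Longrightarrow> f i = 0"
  shows "M_vector TYPE('k::field) d f"
  by (rule M_vector_order_ideal[of "{}"]) (use assms in auto)

text \<open>If \<open>M\<close> of size \<open>k\<close> has maximum \<open>v\<close> and rank at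
  least \<open>g k\<close>, then \<open>a choose k < (v + k) choose k\<close>, so
  \<open>a \<le> v + k - 1\<close>. Any further element then raises the rank by at least
  \<open>a choose (k + 1)\<close>, to \<open>g (k + 1)\<close> or more. Hence the initial segments
  are closed under deletion.\<close>

lemma M_vector_of_growth:
  fixes g :: "nat \<Rightarrow> nat"
  assumes g0: "g 0 = 1"
    and growth: "\<And>k. 1 \<le> k \<Longrightarrow> k < d \<Longrightarrow>
      \<exists>a. a choose k \<le> g k \<and> g (Suc k) \<le> g k + (a choose Suc k)"
  shows "M_vector TYPE('k::field) d (\<lambda>i. int (g i))"
proof (rule M_vector_order_ideal)
  let ?S = "\<lambda>k. {M :: nat multiset. size M = k \<and> mrank M < g k}"
  let ?Ms = "\<Union>k\<in>{..d}. ?S k"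
  have fc: "finite (?S k)" "card (?S k) = g k" for k
    using card_mrank_less[of k "g k"] g0 by (cases k; simp)+
  show "finite ?Ms"
    using fc by blast
  show "int (card {M \<in> ?Ms. size M = i}) = (if i \<le> d then int (g i) else 0)" for i
  proof -
    have "{M \<in> ?Ms. size M = i} = (if i \<le> d then ?S i else {})"
      by auto
    then show ?thesis
      using fc(2)[of i] by simp
  qed
  have down: "M \<in> ?Ms" if "add_mset x M \<in> ?Ms" for x and M :: "nat multiset"
  proof (cases "M = {#}")
    case True
    then show ?thesis
      using g0 by auto
  next
    case False
    let ?k = "size M"
    from that have k: "?k < d" and less: "mrank (add_mset x M) < g (Suc ?k)"
      by auto
    have "1 \<le> ?k"
      using False by (simp add: Suc_le_eq nonempty_has_size)
    then obtain a where a: "a choose ?k \<le> g ?k" "g (Suc ?k) \<le> g ?k + (a choose Suc ?k)"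
      using growth k by blast
    obtain v N where N: "M = add_mset v N" "\<forall>y\<in>#N. y \<le> v"
      using False by (rule ex_max_decomposition)
    have v: "v \<in># M" "\<forall>y\<in>#M. y \<le> v"
      using N by auto
    have "mrank M < g ?k"
    proof (rule ccontr)
      assume *: "\<not> mrank M < g ?k"
      have "a choose ?k < (v + ?k) choose ?k"
        using mrank_less[OF v(2)] a * by linarith
      then have "a \<le> v + ?k - 1"
        using binomial_right_mono[of "v + ?k" a ?k] by linarith
      then have "a choose Suc ?k \<le> (v + ?k - 1) choose Suc ?k"
        by (rule binomial_right_mono)
      then show False
        using mrank_add_ge_binomial[OF v, of x] a less * by linarith
    qed
    then show ?thesis
      using k by auto
  qed
  show "N \<in> ?Ms" if M: "M \<in> ?Ms" and N: "N \<subseteq># M" for M N :: "nat multiset"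
  proof -
    obtain C where "M = N + C"
      using N by (metis subset_mset.add_diff_inverse)
    with M show ?thesis
    proof (induction C arbitrary: M)
      case (add x C)
      then show ?case
        using down[of x "N + C"] by simp
    qed simp
  qed
qed

section \<open>Differences of the coefficients\<close>

lemma coloring_numerator_unconstrained_nth:
  assumes "finite V"
  shows "coloring_numerator V {} {} $ k = eulerian (card V) k"
proof -
  have "Abs_fps (\<lambda>j. int (card (colorings V {} {} (Suc j)))) = Abs_fps (\<lambda>j. (int j + 1) ^ card V)"
    by (rule fps_ext) (simp add: card_colorings_unconstrained[OF assms] add.commute)
  then have "coloring_numerator V {} {} = Abs_fps (eulerian (card V))"
    by (simp only: coloring_numerator_def eulerian_generating_function)
  then show ?thesis by simp
qed

lemma M_vector_cong:
  assumes "M_vector T d f" "\<And>i. i \<le> d \<Longrightarrow> f i = f' i"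
  shows "M_vector T d f'"
proof -
  have "(if i \<le> d then f i else 0) = (if i \<le> d then f' i else 0)" for i
    using assms(2) by simp
  then show ?thesis
    using assms(1) unfolding M_vector_def by simp
qed

lemma nat_ceiling_half: "nat \<lceil>(real n - 2) / 2\<rceil> = (n - 1) div 2"
proof (cases "even n")
  case True
  then obtain q where q: "n = 2 * q" by blast
  have "(real n - 2) / 2 = real_of_int (int q - 1)" by (simp add: q)
  then have "\<lceil>(real n - 2) / 2\<rceil> = int q - 1" by (simp only: ceiling_of_int)
  then show ?thesis by (cases q) (simp_all add: q)
next
  case False
  then obtain q where q: "n = 2 * q + 1" using oddE by blast
  have "\<lceil>(real n - 2) / 2\<rceil> = int q"
    by (rule ceiling_unique) (simp_all add: q field_simps)
  then show ?thesis by (simp add: q)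
qed

text \<open>The lower bound comes from the decomposition, the upper one from monotonicity of the
  graph's numerator. Place \<open>k\<close> of row \<open>card V - 1\<close> and place
  \<open>k + 1\<close> of row \<open>card V\<close> have the same \<open>d\<close>, as
  \<open>gap_binomial\<close> requires.\<close>

lemma improper_difference_bounds:
  fixes V :: "'a set"
  assumes V: "finite V" "A \<subseteq> V \<times> V" "A \<noteq> {}" "\<And>x. (x, x) \<notin> A"
  defines "f \<equiv> \<lambda>k. ((1 - fps_X) * improper_numerator V A) $ k"
  shows "f 0 = 1"
    and "2 * k < card V \<Longrightarrow> int (gap (card V - 1 - k) k) \<le> f k"
    and "2 * k + 2 \<le> card V \<Longrightarrow> f (Suc k) \<le> f k + int (gap (card V - 1 - k) (Suc k))"
proof -
  let ?n = "card V" and ?w = "coloring_numerator V A {}"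
  have f: "f k = eulerian ?n k - ?w $ k" for k
    unfolding f_def
    by (simp add: one_minus_X_times_improper_numerator V(1) coloring_numerator_unconstrained_nth)
  have "V \<noteq> {}" using V by auto
  \<comment> \<open>With a single colour each pair of \<open>A\<close> is monochromatic, so the
    numerator of the graph has constant term 0.\<close>
  have "colorings V A {} (Suc 0) = {}"
  proof (rule equals0I)
    fix c assume c: "c \<in> colorings V A {} (Suc 0)"
    obtain u v where uv: "(u, v) \<in> A" using V(3) by auto
    then have "c u \<noteq> c v" using c by (auto simp: colorings_def)
    moreover have "c u < Suc 0" "c v < Suc 0"
      using c uv V(2) by (auto simp: colorings_def)
    ultimately show False by simp
  qed
  then show "f 0 = 1" by (simp add: f coloring_numerator_def)
  show "int (gap (?n - 1 - k) k) \<le> f k" if k: "2 * k < ?n"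
  proof (cases k)
    case 0
    then show ?thesis using \<open>f 0 = 1\<close> by simp
  next
    case (Suc l)
    obtain v p where vp: "v \<in> V" "binomial_cone (?n - 2) p"
      "improper_numerator V A = coloring_numerator (V - {v}) {} {} + p"
      using improper_numerator_decomposition[OF V] by blast
    have "f k = improper_numerator V A $ k - improper_numerator V A $ l"
      unfolding f_def by (simp add: Suc left_diff_distrib)
    also have "\<dots> = eulerian (?n - 1) k - eulerian (?n - 1) l + (p $ k - p $ l)"
      using vp(1) V(1) by (simp add: vp(3) coloring_numerator_unconstrained_nth)
    also have "eulerian (?n - 1) k - eulerian (?n - 1) l = eulerian_diff (?n - 1) k"
      by (simp add: eulerian_diff_def Suc)
    also have "\<dots> = int (gap (?n - 1 - k) k)"
      using gap_eq_eulerian_diff[of k "?n - 1 - k"] k by simp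
    finally show ?thesis
      using binomial_cone_nth_mono[OF vp(2), of l k] k Suc by simp
  qed
  show "f (Suc k) \<le> f k + int (gap (?n - 1 - k) (Suc k))" if k: "2 * k + 2 \<le> ?n"
  proof -
    have "?w $ k \<le> ?w $ Suc k"
      using binomial_cone_coloring_numerator[OF V(1) \<open>V \<noteq> {}\<close> V(2)] k
      by (intro binomial_cone_nth_mono) auto
    moreover have "eulerian ?n (Suc k) - eulerian ?n k = int (gap (?n - 1 - k) (Suc k))"
      using gap_eq_eulerian_diff[of "Suc k" "?n - 1 - k"] k by (simp add: eulerian_diff_def)
    ultimately show ?thesis by (simp add: f)
  qed
qed

theorem theorem5p6:
  fixes G :: "('a, 'b) pre_digraph" and n :: nat and h :: "nat \<Rightarrow> int"
  assumes "graph G"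
    and "n = card (verts G)"
    and "(\<Sum>i\<le>n. fps_const (h i) * fps_X ^ i) =
      (1 - fps_X) ^ n *
        Abs_fps (\<lambda>j. (int j + 1) ^ n - poly (chromatic_poly G) (int j + 1))"
  shows "(\<forall>i. int (i + 1) \<le> \<lfloor>(real n - 2) / 2\<rfloor> \<longrightarrow> h i \<le> h (i + 1)) \<and>
    (\<forall>i. real i \<le> (real n - 2) / 2 \<longrightarrow> h i \<le> h (n - 2 - i)) \<and>
    M_vector TYPE('k::field) (nat \<lceil>(real n - 2) / 2\<rceil>)
      (\<lambda>i. if i = 0 then h 0 else h i - h (i - 1))"
proof -
  interpret graph G by fact
  define V A where "V = verts G" "A = arcs_ends G"
  note defs = this
  have V: "finite V" "A \<subseteq> V \<times> V" "\<And>x. (x, x) \<notin> A"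
    using no_loops by (auto simp: defs arcs_ends_conv)
  have n: "n = card V" using assms(2) by (simp add: defs)
  let ?H = "improper_numerator V A"
  have "poly (chromatic_poly G) (int j + 1) = int (card (colorings V A {} (Suc j)))" for j
  proof -
    have "proper_colorings G (Suc j) = colorings V A {} (Suc j)"
      by (auto simp: proper_colorings_def colorings_def defs)
    then show ?thesis
      using poly_chromatic_poly[OF assms(1), of "Suc j"] by (simp add: add.commute)
  qed
  then have H: "(\<Sum>i\<le>n. fps_const (h i) * fps_X ^ i) = ?H"
    using assms(3) by (simp add: improper_numerator_def n)
  have h: "h i = ?H $ i" if "i \<le> n" for i
  proof -
    have "?H $ i = (\<Sum>k\<le>n. h k * (if i = k then 1 else 0))"
      unfolding H[symmetric] by (simp add: fps_sum_nth)
    also have "\<dots> = (\<Sum>k\<le>n. if i = k then h k else 0)"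
      by (intro sum.cong) auto
    also have "\<dots> = h i" using that by simp
    finally show ?thesis by simp
  qed
  let ?d = "(n - 1) div 2"
  let ?f = "\<lambda>i. if i = 0 then h 0 else h i - h (i - 1)"
  have i1: "2 * i + 4 \<le> n" if "int (i + 1) \<le> \<lfloor>(real n - 2) / 2\<rfloor>" for i
    using that by (simp add: le_floor_iff)
  have i2: "2 * i + 2 \<le> n" if "real i \<le> (real n - 2) / 2" for i
    using that by simp
  show ?thesis
  proof (cases "A = {}")
    case True
    then have h0: "h i = 0" if "i \<le> n" for i
      using h[OF that] improper_numerator_empty[OF V(1)] by simp
    have "M_vector TYPE('k) ?d ?f"
      using h0 by (intro M_vector_zero) auto
    then show ?thesis
      unfolding nat_ceiling_half using i1 i2 h0 by force
  next
    case False
    obtain v p where vp: "v \<in> V" "binomial_cone (n - 2) p"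
      "?H = coloring_numerator (V - {v}) {} {} + p"
      using improper_numerator_decomposition[OF V(1,2) False V(3)] unfolding n by blast
    obtain a b where ab: "(a, b) \<in> A" using False by auto
    then have "{a, b} \<subseteq> V" "a \<noteq> b" using V(2,3) by auto
    then have n2: "2 \<le> n"
      unfolding n using card_mono[OF V(1), of "{a, b}"] by simp
    have "V - {v} \<noteq> {}" using \<open>{a, b} \<subseteq> V\<close> \<open>a \<noteq> b\<close> by auto
    then have "binomial_cone (card (V - {v}) - 1) (coloring_numerator (V - {v}) {} {})"
      using V(1) by (intro binomial_cone_coloring_numerator) auto
    moreover have "card (V - {v}) - 1 = n - 2"
      using vp(1) V(1) by (simp add: n)
    \<comment> \<open>The order \<open>n - 2\<close> places the centre at
      \<open>(n - 2) / 2\<close>, as (1) and (2) demand.\<close>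
    ultimately have cone: "binomial_cone (n - 2) ?H"
      unfolding vp(3) using vp(2) by (intro binomial_cone_plus) simp_all
    have 1: "h i \<le> h (i + 1)" if "int (i + 1) \<le> \<lfloor>(real n - 2) / 2\<rfloor>" for i
      using i1[OF that] binomial_cone_nth_mono[OF cone, of i "i + 1"] by (simp add: h)
    have 2: "h i \<le> h (n - 2 - i)" if "real i \<le> (real n - 2) / 2" for i
      using i2[OF that] binomial_cone_nth_mono[OF cone, of i "n - 2 - i"] by (simp add: h)
    define f where "f k = ((1 - fps_X) * ?H) $ k" for k
    have f: "?f k = f k" if "k \<le> n" for k
      using that by (cases k) (simp_all add: f_def h left_diff_distrib)
    note bounds = improper_difference_bounds[OF V(1,2) False V(3), folded f_def n]
    have f_nonneg: "0 \<le> f k" if "k \<le> ?d" for k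
      using bounds(2)[of k] that n2 by force
    \<comment> \<open>By \<open>f_nonneg\<close>, passing through \<open>nat\<close> changes none of
      the entries up to \<open>?d\<close>.\<close>
    have "M_vector TYPE('k) ?d (\<lambda>k. int (nat (f k)))"
    proof (rule M_vector_of_growth)
      show "nat (f 0) = 1" using bounds(1) by simp
      fix k assume k: "1 \<le> k" "k < ?d"
      \<comment> \<open>Strictness of \<open>k < ?d\<close> leaves room for
        \<open>d = n - 1 - k \<ge> k + 2\<close>, the range of \<open>gap_binomial\<close>.\<close>
      then have kn: "2 * k + 3 \<le> n" by linarith
      then have "k + 2 \<le> n - 1 - k" by linarith
      then obtain a where a: "a choose k \<le> gap (n - 1 - k) k"
        "gap (n - 1 - k) (Suc k) \<le> a choose Suc k"
        using gap_binomial[OF k(1)] by blast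
      have "int (gap (n - 1 - k) k) \<le> f k" "f (Suc k) \<le> f k + int (gap (n - 1 - k) (Suc k))"
        using bounds(2)[of k] bounds(3)[of k] kn by simp_all
      then show "\<exists>a. a choose k \<le> nat (f k) \<and> nat (f (Suc k)) \<le> nat (f k) + (a choose Suc k)"
        using a by (intro exI[of _ a]) linarith
    qed
    then have "M_vector TYPE('k) ?d ?f"
      by (rule M_vector_cong) (use f f_nonneg in auto)
    then show ?thesis
      unfolding nat_ceiling_half using 1 2 by blast
  qed
qed

end
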